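(* Let $q\ge 3$ be a prime power and let $m=2$, so that $\mathtt{G}=2(P_2+\ldots+P_q)$ on the Hermitian curve $\mathcal{H}_q$. Then $C_{\mathcal{L}}(\mathtt{D},\mathtt{G})$ is a $[q^2-1,2,q^2-q]_{q^2}$ cyclic two-weight code with non-zero weights $q^2-q$ and $q^2-1$. There are exactly $(q^2-1)(q+1)$ codewords of weight $q^2-q$ and exactly $q(q-1)(q^2-1)$ codewords of weight $q^2-1$.
   Context: $\mathcal{H}_q$ is the Hermitian curve over $\mathbb{F}_{q^2}$ with homogeneous equation $X_2^qX_3+X_2X_3^q-X_1^{q+1}=0$ (affine equation $Y^q+Y=X^{q+1}$ with $X=X_1/X_3$, $Y=X_2/X_3$). $P_2,\ldots,P_q$ are the $q-1$ points $(0:b:1)$ with $b\in\mathbb{F}_{q^2}$, $b\ne 0$, $b^q+b=0$. The Riemann-Roch space $\mathcal{L}(\mathtt{G})$ is the $\mathbb{F}_{q^2}$-space of functions $f$ in the function field $\mathbb{F}_{q^2}(x,y)$, $y^q+y=x^{q+1}$, with $f=0$ or $\mathrm{div}(f)+\mathtt{G}\ge 0$. Fix $u,v\in\mathbb{F}_{q^2}$ with $u\neq0$ and $v^q+v=u^{q+1}$, and a generator $\omega$ of $\mathbb{F}_{q^2}^*$; put $Q_i=(\omega^iu:\omega^{(q+1)i}v:1)\in\mathcal{H}_q$ for $i=1,\ldots,q^2-1$ and $\mathtt{D}=Q_1+\ldots+Q_{q^2-1}$. The code $C_{\mathcal{L}}(\mathtt{D},\mathtt{G})\subseteq\mathbb{F}_{q^2}^{q^2-1}$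 is the image of the evaluation map $f\mapsto (f(Q_1),\ldots,f(Q_{q^2-1}))$ on $\mathcal{L}(\mathtt{G})$. An $[n,k,d]_{q^2}$ code is a $k$-dimensional linear code of length $n$ over $\mathbb{F}_{q^2}$ with minimum Hamming distance $d$. A linear code of length $n$ is cyclic if $(c_1,\ldots,c_n)$ being a codeword implies that $(c_2,\ldots,c_n,c_1)$ is a codeword. *)

theory Defs
  imports
    "Jordan_Normal_Form.VS_Connect"
    "HOL-Number_Theory.Prime_Powers"
begin

section \<open>Places, divisors and Riemann--Roch spaces\<close>

text \<open>
  A function field \<open>F\<close> over a constant field is given inside an ambient field of type \<open>'f\<close>: the
  constants are embedded by \<open>emb\<close>, and \<open>F\<close> is a subset of \<open>'f\<close>.
\<close>

inductive_set field_adjoin :: "('k \<Rightarrow> 'f::field) \<Rightarrow> 'f set \<Rightarrow> 'f set"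
  for emb :: "'k \<Rightarrow> 'f" and S :: "'f set" where
  const: "emb c \<in> field_adjoin emb S"
| gen: "s \<in> S \<Longrightarrow> s \<in> field_adjoin emb S"
| add: "a \<in> field_adjoin emb S \<Longrightarrow> b \<in> field_adjoin emb S \<Longrightarrow> a + b \<in> field_adjoin emb S"
| uminus: "a \<in> field_adjoin emb S \<Longrightarrow> - a \<in> field_adjoin emb S"
| mult: "a \<in> field_adjoin emb S \<Longrightarrow> b \<in> field_adjoin emb S \<Longrightarrow> a * b \<in> field_adjoin emb S"
| inverse: "a \<in> field_adjoin emb S \<Longrightarrow> inverse a \<in> field_adjoin emb S"

text \<open>
  A place is identified with its normalized discrete valuation (trivial on constants and with value
  group all of the integers). The value at \<open>0\<close>, mathematically infinity, and the values outside
  \<open>F\<close> are set to the dummy \<open>0\<close>, so that a place is determined by its values on the nonzero elements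
  of \<open>F\<close>; clauses about elements that may vanish therefore treat zero separately.
\<close>

type_synonym 'f place = "'f \<Rightarrow> int"
type_synonym 'f divisor = "'f place \<Rightarrow> int"

definition places :: "('k \<Rightarrow> 'f::field) \<Rightarrow> 'f set \<Rightarrow> 'f place set" where
  "places emb F = {P.
     (\<forall>f. f \<notin> F \<or> f = 0 \<longrightarrow> P f = 0) \<and>
     (\<forall>c. P (emb c) = 0) \<and>
     (\<forall>f\<in>F - {0}. \<forall>g\<in>F - {0}. P (f * g) = P f + P g) \<and>
     (\<forall>f\<in>F - {0}. \<forall>g\<in>F - {0}. f + g \<noteq> 0 \<longrightarrow> min (P f) (P g) \<le> P (f + g)) \<and>
     P ` (F - {0}) = UNIV}"

definition principal_divisor :: "'f \<Rightarrow> 'f divisor" where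
  "principal_divisor f = (\<lambda>P. P f)"

definition place_divisor :: "'f place \<Rightarrow> 'f divisor" where
  "place_divisor P = (\<lambda>R. if R = P then 1 else 0)"

definition riemann_roch_space :: "('k \<Rightarrow> 'f::field) \<Rightarrow> 'f set \<Rightarrow> 'f divisor \<Rightarrow> 'f set" where
  "riemann_roch_space emb F G =
     {f \<in> F. f = 0 \<or> (\<forall>P\<in>places emb F. principal_divisor f P + G P \<ge> 0)}"

text \<open>
  The value at a rational place of a function regular there: the constant with the same residue
  class, i.e. whose difference to \<open>f\<close> lies in the maximal ideal of \<open>P\<close>.
\<close>

definition eval_at :: "('k \<Rightarrow> 'f::field) \<Rightarrow> 'f place \<Rightarrow> 'f \<Rightarrow> 'k" where
  "eval_at emb P f = (THE c. f - emb c = 0 \<or> P (f - emb c) > 0)"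

text \<open>The evaluation divisor is the ordered sum \<open>Q 1 + \<dots> + Q n\<close>; vectors are indexed from \<open>0\<close>.\<close>

definition ag_code ::
  "('k \<Rightarrow> 'f::field) \<Rightarrow> 'f set \<Rightarrow> nat \<Rightarrow> (nat \<Rightarrow> 'f place) \<Rightarrow> 'f divisor \<Rightarrow> 'k vec set" where
  "ag_code emb F n Q G =
     (\<lambda>f. vec n (\<lambda>i. eval_at emb (Q (Suc i)) f)) ` riemann_roch_space emb F G"


section \<open>The Hermitian function field\<close>

locale hermitian_function_field = field_hom emb
  for emb :: "'k::{field,finite} \<Rightarrow> 'f::field" +
  fixes q :: nat and x y :: 'f
  assumes x_transcendental: "p \<noteq> 0 \<Longrightarrow> poly (map_poly emb p) x \<noteq> 0"
    and curve_equation: "y ^ q + y = x ^ (q + 1)"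

text \<open>
  The point \<open>(a : b : 1)\<close> of the (smooth) Hermitian curve, viewed as a place of the function field:
  the unique place at which \<open>x\<close> takes the value \<open>a\<close> and \<open>y\<close> takes the value \<open>b\<close>. Neither
  difference below vanishes, as \<open>x\<close> and \<open>y\<close> are not constant.
\<close>

definition affine_point_place ::
  "('k \<Rightarrow> 'f::field) \<Rightarrow> 'f \<Rightarrow> 'f \<Rightarrow> 'k \<Rightarrow> 'k \<Rightarrow> 'f place" where
  "affine_point_place emb x y a b =
     (THE P. P \<in> places emb (field_adjoin emb {x, y}) \<and> P (x - emb a) > 0 \<and> P (y - emb b) > 0)"

definition hermitian_divisor ::
  "('k::{field,finite} \<Rightarrow> 'f::field) \<Rightarrow> nat \<Rightarrow> 'f \<Rightarrow> 'f \<Rightarrow> int \<Rightarrow> 'f divisor" where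
  "hermitian_divisor emb q x y m =
     (\<lambda>R. m * (\<Sum>b\<in>{b. b \<noteq> 0 \<and> b ^ q + b = 0}. place_divisor (affine_point_place emb x y 0 b) R))"

definition hermitian_code ::
  "('k::{field,finite} \<Rightarrow> 'f::field) \<Rightarrow> nat \<Rightarrow> 'f \<Rightarrow> 'f \<Rightarrow> 'k \<Rightarrow> 'k \<Rightarrow> 'k \<Rightarrow> int \<Rightarrow> 'k vec set" where
  "hermitian_code emb q x y u v \<omega> m =
     ag_code emb (field_adjoin emb {x, y}) (q\<^sup>2 - 1)
       (\<lambda>i. affine_point_place emb x y (\<omega> ^ i * u) (\<omega> ^ ((q + 1) * i) * v))
       (hermitian_divisor emb q x y m)"


section \<open>Linear codes\<close>

definition hamming_dist :: "'k vec \<Rightarrow> 'k vec \<Rightarrow> nat" where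
  "hamming_dist c d = card {i. i < dim_vec c \<and> c $ i \<noteq> d $ i}"

definition hamming_weight :: "'k::zero vec \<Rightarrow> nat" where
  "hamming_weight c = card {i. i < dim_vec c \<and> c $ i \<noteq> 0}"

definition min_distance :: "'k vec set \<Rightarrow> nat" where
  "min_distance C = Inf {hamming_dist c d | c d. c \<in> C \<and> d \<in> C \<and> c \<noteq> d}"

definition linear_code :: "nat \<Rightarrow> 'k::field vec set \<Rightarrow> bool" where
  "linear_code n C \<longleftrightarrow> VectorSpace.subspace class_ring C (module_vec TYPE('k) n)"

definition code_dim :: "nat \<Rightarrow> 'k::field vec set \<Rightarrow> nat" where
  "code_dim n C = vectorspace.dim class_ring (module_vec TYPE('k) n\<lparr>carrier := C\<rparr>)"

definition is_nkd_code :: "nat \<Rightarrow> nat \<Rightarrow> nat \<Rightarrow> 'k::field vec set \<Rightarrow> bool" where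
  "is_nkd_code n k d C \<longleftrightarrow> linear_code n C \<and> code_dim n C = k \<and> min_distance C = d"

definition cyclic_code :: "nat \<Rightarrow> 'k::field vec set \<Rightarrow> bool" where
  "cyclic_code n C \<longleftrightarrow>
     linear_code n C \<and> (\<forall>c\<in>C. vec n (\<lambda>i. c $ (Suc i mod n)) \<in> C)"

definition two_weight_code :: "nat \<Rightarrow> nat \<Rightarrow> nat \<Rightarrow> 'k::field vec set \<Rightarrow> bool" where
  "two_weight_code n w1 w2 C \<longleftrightarrow>
     linear_code n C \<and> w1 \<noteq> w2 \<and> hamming_weight ` (C - {0\<^sub>v n}) = {w1, w2}"

end

theory Submission
  imports
    "HOL-Algebra.Algebraic_Closure_Type"
    "HOL-Number_Theory.Residues"
    "HOL-Computational_Algebra.Formal_Laurent_Series"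
    "Jordan_Normal_Form.Char_Poly"
    Defs
begin

text \<open>
  With \<open>div(x) = P\<^sub>1 + \<dots> + P\<^sub>q - q P\<^sub>\<infinity>\<close> and \<open>div(y) = (q + 1) (P\<^sub>1 - P\<^sub>\<infinity>)\<close>, a function \<open>f\<close> lies
  in \<open>L(G)\<close> iff \<open>x\<^sup>2 f\<close> lies in \<open>L(2 q P\<^sub>\<infinity>)\<close>, which is spanned by \<open>1, x, x\<^sup>2, y\<close>, and vanishes at
  least twice at \<open>P\<^sub>1 = (0 : 0 : 1)\<close>. Hence \<open>L(G)\<close> is spanned by \<open>1\<close> and \<open>y / x\<^sup>2\<close>, and the codewords are
  \<open>(c + d \<zeta>\<^sup>i)\<^sub>i\<close> with \<open>\<zeta> = \<omega>\<^sup>q\<^sup>-\<^sup>1\<close> of order \<open>q + 1\<close>.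

  Enough places are obtained by embedding the function field into Laurent series over the algebraic
  closure \<open>K\<close> of the constants: since \<open>w + w\<^sup>q\<close> is invertible under composition of power series, every
  point of the curve over \<open>K\<close>, and the point at infinity, has an explicit branch. An element that is
  regular at all finite points is a polynomial in \<open>x\<close> and \<open>y\<close>: if an irreducible \<open>p(x)\<close> with root \<open>\<alpha>\<close>
  divides its denominator, then the numerator, of degree less than \<open>q\<close> in \<open>y\<close>, vanishes at the \<open>q\<close>
  distinct points above \<open>\<alpha>\<close> and so is divisible by \<open>p(x)\<close>, too.
\<close>

section \<open>Evaluation of bivariate polynomials\<close>

text \<open>Irreducibility of the curve is not among the locale axioms. It has to be derived,
  because it makes any two pairs that satisfy the axioms over the same constants isomorphic, and
  this is what lets a Laurent series model speak about the abstract field \<open>F\<close>. A second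
  obstacle is that a place is an arbitrary normalized valuation and
  \<open>riemann_roch_space\<close> quantifies over all of them. Membership of \<open>1\<close> and
  \<open>y / x\<^sup>2\<close> thus requires estimates valid at every place; these come from
  comparing the dominating terms in the curve equation. The converse inclusion needs only
  sufficiently many concrete places, but non-rational ones must be among them, whence the algebraic
  closure. Finally, \<open>affine_point_place\<close> is a definite description, so the divisor and
  the evaluation acquire their meaning only once a place with a given rational centre is known to
  exist and to be unique.\<close>

definition ev1 :: "('k::comm_ring_1 \<Rightarrow> 'l::comm_ring_1) \<Rightarrow> 'l \<Rightarrow> 'k poly \<Rightarrow> 'l" where
  "ev1 e \<xi> p = poly (map_poly e p) \<xi>"

text \<open>The inner variable stands for x and the outer one for y. Iterating \<open>ev1\<close>
  makes each fact about one variable serve twice, since \<open>ev1 e \<xi>\<close> is a ring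
  homomorphism whenever \<open>e\<close> is.\<close>

definition ev2 :: "('k::comm_ring_1 \<Rightarrow> 'l::comm_ring_1) \<Rightarrow> 'l \<Rightarrow> 'l \<Rightarrow> 'k poly poly \<Rightarrow> 'l" where
  "ev2 e \<xi> \<eta> = ev1 (ev1 e \<xi>) \<eta>"

lemma ev1_hom:
  assumes "comm_ring_hom e"
  shows "comm_ring_hom (ev1 e \<xi>)"
proof -
  interpret e: comm_ring_hom e by fact
  interpret m: map_poly_comm_ring_hom e ..
  show ?thesis
    by unfold_locales (auto simp: ev1_def m.hom_add m.hom_mult)
qed

lemma ev2_hom: "comm_ring_hom e \<Longrightarrow> comm_ring_hom (ev2 e \<xi> \<eta>)"
  unfolding ev2_def by (intro ev1_hom)

lemma ev1_pCons:
  assumes "comm_ring_hom e"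
  shows "ev1 e \<xi> (pCons c p) = e c + \<xi> * ev1 e \<xi> p"
proof -
  interpret e: comm_ring_hom e by fact
  show ?thesis by (simp add: ev1_def e.map_poly_pCons_hom)
qed

lemma ev1_monom:
  assumes "comm_ring_hom e"
  shows "ev1 e \<xi> (monom c n) = e c * \<xi> ^ n"
proof -
  interpret e: comm_ring_hom e by fact
  show ?thesis by (simp add: ev1_def map_poly_monom poly_monom)
qed

lemma ev1_0 [simp]: "ev1 e \<xi> 0 = 0"
  by (simp add: ev1_def)

lemma ev2_pCons:
  assumes "comm_ring_hom e"
  shows "ev2 e \<xi> \<eta> (pCons p A) = ev1 e \<xi> p + \<eta> * ev2 e \<xi> \<eta> A"
  unfolding ev2_def by (rule ev1_pCons[OF ev1_hom[OF assms]])

lemma ev2_const: "comm_ring_hom e \<Longrightarrow> ev2 e \<xi> \<eta> [:p:] = ev1 e \<xi> p"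
  unfolding ev2_def by (simp add: ev1_pCons ev1_hom)

lemma ev1_const: "comm_ring_hom e \<Longrightarrow> ev1 e \<xi> [:c:] = e c"
  by (simp add: ev1_pCons)

lemma ev1_1:
  assumes "comm_ring_hom e"
  shows "ev1 e \<xi> 1 = 1"
proof -
  interpret e: comm_ring_hom "ev1 e \<xi>" using ev1_hom[OF assms] .
  show ?thesis by simp
qed

lemma ev1_comp:
  assumes "comm_ring_hom e" "comm_ring_hom h"
  shows "h (ev1 e \<xi> p) = ev1 (\<lambda>c. h (e c)) (h \<xi>) p"
proof -
  interpret e: comm_ring_hom e by fact
  interpret h: comm_ring_hom h by fact
  interpret c: comm_ring_hom "\<lambda>c. h (e c)"
    by unfold_locales (auto simp: e.hom_add e.hom_mult h.hom_add h.hom_mult)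
  show ?thesis
    by (induction p)
      (simp_all add: ev1_pCons e.comm_ring_hom_axioms c.comm_ring_hom_axioms h.hom_add h.hom_mult)
qed

lemma ev2_comp:
  assumes "comm_ring_hom e" "comm_ring_hom h"
  shows "h (ev2 e \<xi> \<eta> A) = ev2 (\<lambda>c. h (e c)) (h \<xi>) (h \<eta>) A"
  unfolding ev2_def ev1_comp[OF ev1_hom[OF assms(1)] assms(2)] ev1_comp[OF assms] ..

definition hermitian_poly :: "nat \<Rightarrow> 'k::comm_ring_1 poly poly" where
  "hermitian_poly q = monom 1 q + monom 1 1 - [:monom 1 (q + 1):]"

lemma ev2_hermitian_poly:
  assumes "comm_ring_hom e"
  shows "ev2 e \<xi> \<eta> (hermitian_poly q) = \<eta> ^ q + \<eta> - \<xi> ^ (q + 1)"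
proof -
  interpret e: comm_ring_hom e by fact
  interpret E1: comm_ring_hom "ev1 e \<xi>" using ev1_hom[OF assms] .
  interpret E: comm_ring_hom "ev2 e \<xi> \<eta>" using ev2_hom[OF assms] .
  have "ev2 e \<xi> \<eta> (monom 1 n) = \<eta> ^ n" for n
    unfolding ev2_def by (simp add: ev1_monom[OF E1.comm_ring_hom_axioms])
  then show ?thesis
    using ev1_monom[OF assms, of \<xi> 1 "q + 1"]
    by (simp only: hermitian_poly_def E.hom_add E.hom_minus ev2_const[OF assms]) simp
qed

lemma degree_hermitian_poly:
  assumes "2 \<le> q"
  shows "degree (hermitian_poly q :: 'k::field poly poly) = q"
    and "lead_coeff (hermitian_poly q :: 'k poly poly) = 1"
proof -
  have "degree (monom 1 1 - [:monom 1 (q + 1):] :: 'k poly poly) \<le> 1"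
    by (intro degree_diff_le) (auto simp: degree_monom_eq)
  then have less: "degree (monom 1 1 - [:monom 1 (q + 1):] :: 'k poly poly) < q"
    using assms by linarith
  have eq: "hermitian_poly q = monom 1 q + (monom 1 1 - [:monom 1 (q + 1):] :: 'k poly poly)"
    by (simp add: hermitian_poly_def algebra_simps)
  show "degree (hermitian_poly q :: 'k poly poly) = q"
    unfolding eq by (subst degree_add_eq_left) (use less in \<open>auto simp: degree_monom_eq\<close>)
  then show "lead_coeff (hermitian_poly q :: 'k poly poly) = 1"
    using coeff_eq_0[OF less] by (simp add: eq)
qed

section \<open>Valuations and weighted degrees\<close>

text \<open>One interface for three valuations: places on \<open>F\<close>, the subdegree of Laurent
  series, and minus the degree of polynomials. The last one is why \<open>S\<close> is closed under
  ring operations only. The value at 0 is left open, hence the premises about nonzero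
  elements.\<close>

locale valuation =
  fixes S :: "'l::idom set" and v :: "'l \<Rightarrow> int"
  assumes one_closed [simp, intro]: "1 \<in> S"
    and add_closed [simp, intro]: "a \<in> S \<Longrightarrow> b \<in> S \<Longrightarrow> a + b \<in> S"
    and uminus_closed [simp, intro]: "a \<in> S \<Longrightarrow> - a \<in> S"
    and mult_closed [simp, intro]: "a \<in> S \<Longrightarrow> b \<in> S \<Longrightarrow> a * b \<in> S"
    and v_mult: "a \<in> S \<Longrightarrow> b \<in> S \<Longrightarrow> a \<noteq> 0 \<Longrightarrow> b \<noteq> 0 \<Longrightarrow> v (a * b) = v a + v b"
    and v_add: "a \<in> S \<Longrightarrow> b \<in> S \<Longrightarrow> a \<noteq> 0 \<Longrightarrow> b \<noteq> 0 \<Longrightarrow> a + b \<noteq> 0 \<Longrightarrow> min (v a) (v b) \<le> v (a + b)"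
begin

lemma zero_closed [simp, intro]: "0 \<in> S"
  using add_closed[OF one_closed uminus_closed[OF one_closed]] by simp

lemma diff_closed [simp, intro]: "a \<in> S \<Longrightarrow> b \<in> S \<Longrightarrow> a - b \<in> S"
  using add_closed[of a "- b"] by simp

lemma power_closed [simp, intro]: "a \<in> S \<Longrightarrow> a ^ n \<in> S"
  by (induction n) auto

lemma v_one [simp]: "v 1 = 0"
  using v_mult[of 1 1] by simp

lemma v_uminus:
  assumes "a \<in> S"
  shows "v (- a) = v a"
proof (cases "a = 0")
  case False
  have "v (- 1) = 0"
    using v_mult[of "- 1" "- 1"] by simp
  then show ?thesis
    using v_mult[of "- 1" a] False assms by simp
qed simp

lemma v_power: "a \<in> S \<Longrightarrow> a \<noteq> 0 \<Longrightarrow> v (a ^ n) = int n * v a"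
  by (induction n) (auto simp: v_mult algebra_simps)

lemma v_add_strict:
  assumes "a \<in> S" "b \<in> S" "a \<noteq> 0" "b \<noteq> 0" "v a < v b"
  shows "a + b \<noteq> 0" "v (a + b) = v a"
proof -
  show nz: "a + b \<noteq> 0"
    using assms v_uminus[of b] by (auto simp: add_eq_0_iff2)
  have "min (v a) (v b) \<le> v (a + b)"
    using assms nz by (intro v_add) auto
  moreover have "min (v (a + b)) (v (- b)) \<le> v (a + b + - b)"
    using assms nz by (intro v_add) auto
  ultimately show "v (a + b) = v a"
    using assms v_uminus[of b] by auto
qed

lemma v_add_neq:
  assumes "a \<in> S" "b \<in> S" "a \<noteq> 0" "b \<noteq> 0" "v a \<noteq> v b"
  shows "a + b \<noteq> 0" "v (a + b) = min (v a) (v b)"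
  using v_add_strict[of a b] v_add_strict[of b a] assms
  by (cases "v a < v b"; auto simp: add.commute)+

lemma ev1_closed:
  assumes "comm_ring_hom e" "range e \<subseteq> S" "\<xi> \<in> S"
  shows "ev1 e \<xi> p \<in> S"
  using assms(2,3) by (induction p) (auto simp: ev1_pCons[OF assms(1)])

lemma ev2_closed:
  assumes "comm_ring_hom e" "range e \<subseteq> S" "\<xi> \<in> S" "\<eta> \<in> S"
  shows "ev2 e \<xi> \<eta> A \<in> S"
  unfolding ev2_def using assms by (intro ev1_closed ev1_hom) (auto intro!: ev1_closed)

text \<open>Horner's scheme: \<open>\<xi>\<close> has a pole and nonzero constants have value 0, so
  each newly added constant is strictly dominated and the leading term decides.\<close>

lemma v_ev1:
  assumes "comm_ring_hom e" "range e \<subseteq> S" "\<xi> \<in> S" "\<xi> \<noteq> 0"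
    and "\<And>c. c \<noteq> 0 \<Longrightarrow> e c \<noteq> 0 \<and> v (e c) = 0"
    and "v \<xi> = - int q" "0 < q" "p \<noteq> 0"
  shows "ev1 e \<xi> p \<noteq> 0 \<and> v (ev1 e \<xi> p) = - int (q * degree p)"
  using \<open>p \<noteq> 0\<close>
proof (induction p)
  case (pCons c p)
  interpret e: comm_ring_hom e by fact
  show ?case
  proof (cases "p = 0")
    case True
    then show ?thesis using pCons assms(5) by (simp add: ev1_pCons[OF assms(1)])
  next
    case False
    have eS: "e c \<in> S" "ev1 e \<xi> p \<in> S"
      using assms by (auto intro: ev1_closed)
    have *: "\<xi> * ev1 e \<xi> p \<noteq> 0" "v (\<xi> * ev1 e \<xi> p) = - int (q * degree (pCons c p))"
      using pCons.IH False assms eS by (auto simp: v_mult algebra_simps)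
    show ?thesis
    proof (cases "c = 0")
      case True
      then show ?thesis using * by (simp add: ev1_pCons[OF assms(1)])
    next
      case c: False
      have "v (\<xi> * ev1 e \<xi> p) < v (e c)"
        using * assms(5)[OF c] False \<open>0 < q\<close> by (simp del: of_nat_mult)
      then show ?thesis
        using v_add_strict[of "\<xi> * ev1 e \<xi> p" "e c"] * assms(3) assms(5)[OF c] eS
        by (auto simp: ev1_pCons[OF assms(1)] add.commute)
    qed
  qed
qed simp

text \<open>The weights of the monomials \<open>x\<^sup>i y\<^sup>j\<close> with \<open>j < q\<close> are pairwise distinct, since they determine
  \<open>j\<close> modulo \<open>q\<close>.\<close>

lemma v_ev2:
  assumes "comm_ring_hom e" "range e \<subseteq> S" "\<xi> \<in> S" "\<xi> \<noteq> 0" "\<eta> \<in> S" "\<eta> \<noteq> 0"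
    and "\<And>c. c \<noteq> 0 \<Longrightarrow> e c \<noteq> 0 \<and> v (e c) = 0"
    and "v \<xi> = - int q" "v \<eta> = - int (q + 1)" "0 < q"
    and "A \<noteq> 0" "degree A < q"
  shows "ev2 e \<xi> \<eta> A \<noteq> 0 \<and>
    (\<exists>j. coeff A j \<noteq> 0 \<and> v (ev2 e \<xi> \<eta> A) = - int (q * degree (coeff A j) + (q + 1) * j)) \<and>
    (\<forall>j. coeff A j \<noteq> 0 \<longrightarrow> v (ev2 e \<xi> \<eta> A) \<le> - int (q * degree (coeff A j) + (q + 1) * j))"
  using \<open>A \<noteq> 0\<close> \<open>degree A < q\<close>
proof (induction A)
  case (pCons a A)
  have w1: "ev1 e \<xi> p \<noteq> 0 \<and> v (ev1 e \<xi> p) = - int (q * degree p)" if "p \<noteq> 0" for p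
    using assms that by (intro v_ev1) auto
  have S: "ev1 e \<xi> a \<in> S" "ev2 e \<xi> \<eta> A \<in> S" "\<eta> * ev2 e \<xi> \<eta> A \<in> S"
    using assms by (auto intro!: ev1_closed ev2_closed)
  show ?case
  proof (cases "A = 0")
    case True
    then have a: "a \<noteq> 0" using pCons by simp
    have "ev2 e \<xi> \<eta> (pCons a A) = ev1 e \<xi> a"
      using True by (simp add: ev2_const assms(1))
    then show ?thesis
      using w1[OF a] a True
      by (intro conjI exI[of _ 0] allI) (auto simp: coeff_pCons split: nat.splits)
  next
    case False
    then have "degree A < q" and dA: "Suc (degree A) < q" using pCons.prems by auto
    note IH = pCons.IH[OF False this(1)]
    then obtain j where j: "coeff A j \<noteq> 0"
      "v (ev2 e \<xi> \<eta> A) = - int (q * degree (coeff A j) + (q + 1) * j)" by blast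
    have nz: "\<eta> * ev2 e \<xi> \<eta> A \<noteq> 0" using IH \<open>\<eta> \<noteq> 0\<close> by simp
    have vY: "v (\<eta> * ev2 e \<xi> \<eta> A) = - int (q + 1) + v (ev2 e \<xi> \<eta> A)"
      using IH assms S by (simp add: v_mult)
    then have vj: "v (\<eta> * ev2 e \<xi> \<eta> A) = - int (q * degree (coeff A j) + (q + 1) * Suc j)"
      using j by (simp add: algebra_simps)
    have Yle: "v (\<eta> * ev2 e \<xi> \<eta> A) \<le> - int (q * degree (coeff A i) + (q + 1) * Suc i)"
      if "coeff A i \<noteq> 0" for i
    proof -
      have "v (ev2 e \<xi> \<eta> A) \<le> - int (q * degree (coeff A i) + (q + 1) * i)" using IH that by blast
      then show ?thesis using vY by (simp add: algebra_simps)
    qed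
    have "j \<le> degree A" using j(1) by (rule le_degree)
    then have jq: "Suc j < q" using dA by simp
    show ?thesis
    proof (cases "a = 0")
      case True
      then have "ev2 e \<xi> \<eta> (pCons a A) = \<eta> * ev2 e \<xi> \<eta> A"
        by (simp add: ev2_pCons[OF assms(1)])
      moreover have "v (\<eta> * ev2 e \<xi> \<eta> A) \<le> - int (q * degree (coeff (pCons a A) i) + (q + 1) * i)"
        if "coeff (pCons a A) i \<noteq> 0" for i
        using that True Yle[of "i - 1"] by (cases i) simp_all
      ultimately show ?thesis
        using nz vj j(1) by (intro conjI exI[of _ "Suc j"] allI) auto
    next
      case a: False
      note wa = w1[OF a]
      have "v (ev1 e \<xi> a) \<noteq> v (\<eta> * ev2 e \<xi> \<eta> A)"
      proof
        assume "v (ev1 e \<xi> a) = v (\<eta> * ev2 e \<xi> \<eta> A)"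
        then have "q * degree a = q * degree (coeff A j) + (q + 1) * Suc j"
          using wa vj by (metis neg_equal_iff_equal of_nat_eq_iff)
        then have "q * degree a = q * (degree (coeff A j) + Suc j) + Suc j"
          by (simp add: algebra_simps)
        then have "q dvd Suc j" by (metis dvd_add_right_iff dvd_triv_left)
        then show False using jq by (simp add: nat_dvd_not_less)
      qed
      from v_add_neq[OF S(1) S(3) _ nz this] wa
      have sum: "ev2 e \<xi> \<eta> (pCons a A) \<noteq> 0"
        "v (ev2 e \<xi> \<eta> (pCons a A)) = min (v (ev1 e \<xi> a)) (v (\<eta> * ev2 e \<xi> \<eta> A))"
        by (auto simp: ev2_pCons[OF assms(1)])
      have ex: "\<exists>i. coeff (pCons a A) i \<noteq> 0 \<and>
        v (ev2 e \<xi> \<eta> (pCons a A)) = - int (q * degree (coeff (pCons a A) i) + (q + 1) * i)"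
      proof (cases "v (ev1 e \<xi> a) \<le> v (\<eta> * ev2 e \<xi> \<eta> A)")
        case True
        then show ?thesis using sum wa a by (intro exI[of _ 0]) auto
      next
        case False
        then show ?thesis using sum vj j(1) by (intro exI[of _ "Suc j"]) auto
      qed
      have "v (ev2 e \<xi> \<eta> (pCons a A)) \<le> - int (q * degree (coeff (pCons a A) i) + (q + 1) * i)"
        if "coeff (pCons a A) i \<noteq> 0" for i
      proof (cases i)
        case 0
        then show ?thesis using sum wa by simp
      next
        case (Suc n)
        then show ?thesis using sum Yle[of n] that by simp
      qed
      then show ?thesis using sum ex by blast
    qed
  qed
qed simp

end

section \<open>Irreducibility of the Hermitian polynomial\<close>

lemma valuation_degree: "valuation UNIV (\<lambda>p :: 'k::field poly. - int (degree p))"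
proof
  fix a b :: "'k poly"
  assume "a \<noteq> 0" "b \<noteq> 0" "a + b \<noteq> 0"
  have "degree (a + b) \<le> max (degree a) (degree b)" by (rule degree_add_le_max)
  then show "min (- int (degree a)) (- int (degree b)) \<le> - int (degree (a + b))"
    by linarith
qed (auto simp: degree_mult_eq)

text \<open>If the Hermitian polynomial split, its degree at \<open>(T\<^sup>q, z T\<^sup>q\<^sup>+\<^sup>1)\<close> would not depend on \<open>z\<close>.\<close>

lemma hermitian_poly_no_factor:
  fixes D Q :: "'k::field poly poly" and z :: 'k
  assumes "2 \<le> q" and z: "z \<noteq> 0" "z ^ q \<noteq> 1"
    and "D \<noteq> 0" "degree D < q" "Q \<noteq> 0" "degree Q < q" "L \<noteq> 0"
    and eq: "smult L (hermitian_poly q) = D * Q"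
  shows False
proof -
  interpret valuation UNIV "\<lambda>p :: 'k poly. - int (degree p)" by (rule valuation_degree)
  have e: "comm_ring_hom (\<lambda>c :: 'k. [:c:])" by unfold_locales auto
  let ?T = "monom 1 q :: 'k poly" and ?Z = "\<lambda>z :: 'k. monom z (q + 1)"
  let ?ev = "\<lambda>z. ev2 (\<lambda>c :: 'k. [:c:]) ?T (?Z z)"
  have dd: "degree (?ev z (hermitian_poly q)) = degree (?ev 1 (hermitian_poly q))"
  proof -
    \<comment> \<open>Minus the degree is a valuation with the weights of \<open>v_ev2\<close>, so
      the degree after substitution is the largest weight occurring in \<open>A\<close>, whatever
      the nonzero \<open>z'\<close> is.\<close>
    have w: "?ev z' A \<noteq> 0" "\<exists>j. coeff A j \<noteq> 0 \<and> degree (?ev z' A) = q * degree (coeff A j) + (q + 1) * j"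
      "\<And>j. coeff A j \<noteq> 0 \<Longrightarrow> q * degree (coeff A j) + (q + 1) * j \<le> degree (?ev z' A)"
      if "A \<noteq> 0" "degree A < q" "z' \<noteq> 0" for A z'
    proof -
      have "?ev z' A \<noteq> 0 \<and>
        (\<exists>j. coeff A j \<noteq> 0 \<and> - int (degree (?ev z' A)) = - int (q * degree (coeff A j) + (q + 1) * j)) \<and>
        (\<forall>j. coeff A j \<noteq> 0 \<longrightarrow> - int (degree (?ev z' A)) \<le> - int (q * degree (coeff A j) + (q + 1) * j))"
        using that assms(1) by (intro v_ev2[OF e]) (auto simp: degree_monom_eq)
      then show "?ev z' A \<noteq> 0" "\<exists>j. coeff A j \<noteq> 0 \<and> degree (?ev z' A) = q * degree (coeff A j) + (q + 1) * j"
        "\<And>j. coeff A j \<noteq> 0 \<Longrightarrow> q * degree (coeff A j) + (q + 1) * j \<le> degree (?ev z' A)"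
        by (simp_all del: of_nat_add of_nat_mult)
    qed
    have same: "degree (?ev z A) = degree (?ev 1 A)" if "A \<noteq> 0" "degree A < q" for A
      using w[OF that, of z] w[OF that, of 1] z by (metis one_neq_zero order_antisym)
    have mult: "degree (ev1 (\<lambda>c :: 'k. [:c:]) ?T L) + degree (?ev z' (hermitian_poly q)) =
        degree (?ev z' D) + degree (?ev z' Q) \<and> ?ev z' D \<noteq> 0" if "z' \<noteq> 0" for z'
    proof -
      interpret E: comm_ring_hom "?ev z'" using ev2_hom[OF e] .
      have "ev1 (\<lambda>c :: 'k. [:c:]) ?T L * ?ev z' (hermitian_poly q) = ?ev z' ([:L:] * hermitian_poly q)"
        by (simp only: E.hom_mult ev2_const[OF e])
      also have "\<dots> = ?ev z' D * ?ev z' Q"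
        using eq E.hom_mult by simp
      finally have *: "ev1 (\<lambda>c :: 'k. [:c:]) ?T L * ?ev z' (hermitian_poly q) = ?ev z' D * ?ev z' Q" .
      moreover have "?ev z' D \<noteq> 0" "?ev z' Q \<noteq> 0" using w(1) assms that by auto
      ultimately show ?thesis
        by (metis degree_mult_eq mult_eq_0_iff)
    qed
    show ?thesis
      using mult[OF z(1)] mult[of 1] same[of D] same[of Q] assms by simp
  qed
  \<comment> \<open>The top coefficient \<open>z' ^ q - 1\<close> vanishes for \<open>z' = 1\<close>
    and survives for the given \<open>z\<close>, so the two degrees are q + 1 and q (q + 1).\<close>
  have ev: "?ev z' (hermitian_poly q) = monom (z' ^ q - 1) (q * (q + 1)) + monom z' (q + 1)" for z'
    unfolding ev2_hermitian_poly[OF e]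
    by (simp add: monom_power diff_monom[symmetric] mult_monom algebra_simps)
  have lt: "q + 1 < q * (q + 1)"
    using mult_strict_right_mono[of 1 q "q + 1"] assms(1) by (simp only: mult_1)
  have "degree (?ev 1 (hermitian_poly q)) = q + 1"
    unfolding ev by (simp add: degree_monom_eq)
  moreover have "degree (?ev z (hermitian_poly q)) = q * (q + 1)"
    unfolding ev using z lt by (subst degree_add_eq_left) (auto simp: degree_monom_eq)
  ultimately show False using dd lt by simp
qed

text \<open>Euclid's algorithm in y without fractions: by pseudo-division, a nonzero combination of
  least y-degree divides a k[x]-multiple of the Hermitian polynomial, hence has y-degree 0. The
  resulting \<open>N\<close>, a polynomial in x alone, serves as a norm of \<open>B\<close>.\<close>

lemma hermitian_poly_norm:
  fixes B :: "'k::field poly poly" and z :: 'k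
  assumes "2 \<le> q" and z: "z \<noteq> 0" "z ^ q \<noteq> 1" and B: "B \<noteq> 0" "degree B < q"
  shows "\<exists>U V N. N \<noteq> 0 \<and> U * B + V * hermitian_poly q = [:N:]"
proof -
  let ?h = "hermitian_poly q :: 'k poly poly"
  let ?P = "\<lambda>D. D \<noteq> 0 \<and> (\<exists>U V. D = U * B + V * ?h)"
  have "?P B" using B by (intro conjI exI[of _ 1] exI[of _ 0]) auto
  then obtain D where D: "?P D" and min: "\<And>D'. ?P D' \<Longrightarrow> degree D \<le> degree D'"
    using ex_has_least_nat[of ?P B degree] by blast
  obtain U V where UV: "D = U * B + V * ?h" using D by blast
  obtain Q R where QR: "pseudo_divmod ?h D = (Q, R)" by fastforce
  define L where "L = lead_coeff D ^ (Suc (degree ?h) - degree D)"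
  have L: "L \<noteq> 0" using D by (simp add: L_def)
  have pd: "smult L ?h = D * Q + R" "R = 0 \<or> degree R < degree D"
    using pseudo_divmod[of D, OF _ QR] D by (auto simp: L_def)
  have "R = (- Q * U) * B + ([:L:] - Q * V) * ?h"
    using pd(1) UV by (simp add: algebra_simps)
  then have "R = 0"
    using min[of R] pd(2) by (metis not_le)
  then have eq: "smult L ?h = D * Q" using pd by simp
  have h: "degree ?h = q" "?h \<noteq> 0"
    using degree_hermitian_poly[OF assms(1), where 'k = 'k] by force+
  have Q: "Q \<noteq> 0" using eq L h by auto
  have "q = degree D + degree Q"
    using arg_cong[OF eq, of degree] L h D Q by (simp add: degree_mult_eq)
  moreover have "degree D < q" using min[OF \<open>?P B\<close>] B by simp
  ultimately have "degree D = 0"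
    using hermitian_poly_no_factor[OF assms(1) z _ _ Q _ L eq] D by (cases "degree Q < q") auto
  then obtain N where "D = [:N:]" using degree_eq_zeroE by blast
  then show ?thesis using D by (metis pCons_0_0)
qed

section \<open>The Hermitian function field\<close>

context hermitian_function_field
begin

abbreviation "F \<equiv> field_adjoin emb {x, y}"

abbreviation "ev \<equiv> ev2 emb x y"

lemma comm_ring_hom_emb: "comm_ring_hom emb"
  by (rule comm_ring_hom_axioms)

sublocale ev: comm_ring_hom ev
  by (rule ev2_hom[OF comm_ring_hom_emb])

lemma ev1_nonzero: "p \<noteq> 0 \<Longrightarrow> ev1 emb x p \<noteq> 0"
  unfolding ev1_def by (rule x_transcendental)

lemma ev_hermitian_poly [simp]: "ev (hermitian_poly q) = 0"
  using curve_equation by (simp add: ev2_hermitian_poly[OF comm_ring_hom_emb])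

lemma ev_const [simp]: "ev [:[:c:]:] = emb c"
  by (simp add: ev2_const ev1_const comm_ring_hom_emb)

lemma ev_x [simp]: "ev [:[:0, 1:]:] = x"
  by (simp add: ev2_const ev1_pCons comm_ring_hom_emb)

lemma ev_y [simp]: "ev [:0, 1:] = y"
  by (simp add: ev2_pCons comm_ring_hom_emb ev1_1)

lemma F_0 [simp]: "0 \<in> F"
  using field_adjoin.const[of emb 0 "{x, y}"] by simp

lemma F_1 [simp]: "1 \<in> F"
  using field_adjoin.const[of emb 1 "{x, y}"] by simp

lemma F_const [simp]: "emb c \<in> F" and F_x [simp]: "x \<in> F" and F_y [simp]: "y \<in> F"
  by (auto intro: field_adjoin.const field_adjoin.gen)

lemma F_add: "a \<in> F \<Longrightarrow> b \<in> F \<Longrightarrow> a + b \<in> F"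
  and F_mult: "a \<in> F \<Longrightarrow> b \<in> F \<Longrightarrow> a * b \<in> F"
  and F_uminus: "a \<in> F \<Longrightarrow> - a \<in> F"
  and F_inverse: "a \<in> F \<Longrightarrow> inverse a \<in> F"
  by (fact field_adjoin.add field_adjoin.mult field_adjoin.uminus field_adjoin.inverse)+

lemma F_diff: "a \<in> F \<Longrightarrow> b \<in> F \<Longrightarrow> a - b \<in> F"
  using F_add[of a "- b"] F_uminus[of b] by simp

lemma F_divide: "a \<in> F \<Longrightarrow> b \<in> F \<Longrightarrow> a / b \<in> F"
  unfolding divide_inverse by (intro F_mult F_inverse)

lemma F_power: "a \<in> F \<Longrightarrow> a ^ n \<in> F"
  by (induction n) (auto intro: F_mult)

lemmas F_intros = F_add F_mult F_uminus F_inverse F_diff F_divide F_power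

lemma ev1_in_F: "ev1 emb x p \<in> F"
  by (induction p) (auto simp: ev1_pCons comm_ring_hom_emb intro!: F_intros)

lemma ev_in_F [simp]: "ev A \<in> F"
  by (induction A) (auto simp: ev2_pCons comm_ring_hom_emb intro!: F_intros ev1_in_F)

lemma F_quotientE:
  assumes "f \<in> F"
  obtains A B where "ev B \<noteq> 0" "f = ev A / ev B"
proof -
  from assms have "\<exists>A B. ev B \<noteq> 0 \<and> f = ev A / ev B"
  proof induction
    case (const c)
    show ?case by (intro exI[of _ "[:[:c:]:]"] exI[of _ 1]) simp
  next
    case (gen s)
    then consider "s = x" | "s = y" by blast
    then show ?case
    proof cases
      case 1
      then show ?thesis by (intro exI[of _ "[:[:0, 1:]:]"] exI[of _ 1]) simp
    next
      case 2
      then show ?thesis by (intro exI[of _ "[:0, 1:]"] exI[of _ 1]) simp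
    qed
  next
    case (add a b)
    then obtain A B A' B' where "ev B \<noteq> 0" "a = ev A / ev B" "ev B' \<noteq> 0" "b = ev A' / ev B'"
      by blast
    then show ?case
      by (intro exI[of _ "A * B' + A' * B"] exI[of _ "B * B'"])
        (simp add: ev.hom_add ev.hom_mult add_frac_eq)
  next
    case (uminus a)
    then obtain A B where "ev B \<noteq> 0" "a = ev A / ev B" by blast
    then show ?case by (intro exI[of _ "- A"] exI[of _ B]) (simp add: ev.hom_uminus)
  next
    case (mult a b)
    then obtain A B A' B' where "ev B \<noteq> 0" "a = ev A / ev B" "ev B' \<noteq> 0" "b = ev A' / ev B'"
      by blast
    then show ?case
      by (intro exI[of _ "A * A'"] exI[of _ "B * B'"]) (simp add: ev.hom_mult)
  next
    case (inverse a)
    then obtain A B where AB: "ev B \<noteq> 0" "a = ev A / ev B" by blast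
    show ?case
    proof (cases "a = 0")
      case True
      then show ?thesis by (intro exI[of _ 0] exI[of _ 1]) simp
    next
      case False
      then show ?thesis using AB by (intro exI[of _ B] exI[of _ A]) simp
    qed
  qed
  then show thesis using that by blast
qed

end

section \<open>Normal forms in the function field\<close>

locale hermitian_field = hermitian_function_field emb q x y
  for emb :: "'k::{field,finite} \<Rightarrow> 'f::field" and q x y +
  assumes q2: "2 \<le> q" and card_gt: "q + 1 < card (UNIV :: 'k set)"
begin

text \<open>Such a \<open>z\<close> is the parameter of \<open>hermitian_poly_no_factor\<close>.
  Nothing links \<open>q\<close> to the characteristic at this point, so roots are counted
  instead.\<close>

lemma ex_non_root_of_unity: "\<exists>z :: 'k. z \<noteq> 0 \<and> z ^ q \<noteq> 1"
proof (rule ccontr)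
  assume *: "\<not> ?thesis"
  let ?p = "monom 1 q - 1 :: 'k poly"
  have p: "degree ?p = q" "?p \<noteq> 0"
  proof -
    have "degree (monom 1 q + - 1 :: 'k poly) = q"
      using q2 by (subst degree_add_eq_left) (auto simp: degree_monom_eq)
    then show "degree ?p = q" by simp
    then show "?p \<noteq> 0" using q2 by force
  qed
  have "UNIV - {0} \<subseteq> {z. poly ?p z = 0}" using * by (auto simp: poly_monom)
  then have "card (UNIV - {0 :: 'k}) \<le> card {z. poly ?p z = 0}"
    by (intro card_mono poly_roots_finite p)
  also have "\<dots> \<le> q" using card_poly_roots_bound[OF p(2)] p(1) by simp
  finally show False using card_gt by simp
qed

text \<open>Some multiple of \<open>ev B\<close> is a nonzero polynomial in x, hence nonzero by
  transcendence. This shows that no such \<open>B\<close> is killed by evaluation, and it removes y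
  from denominators.\<close>

lemma ev_norm:
  assumes "B \<noteq> 0" "degree B < q"
  obtains U N where "N \<noteq> 0" "ev U * ev B = ev1 emb x N"
proof -
  obtain z :: 'k where "z \<noteq> 0" "z ^ q \<noteq> 1" using ex_non_root_of_unity by blast
  from hermitian_poly_norm[OF q2 this assms] obtain U V N
    where "N \<noteq> 0" and eq: "U * B + V * hermitian_poly q = [:N:]" by blast
  moreover have "ev U * ev B = ev1 emb x N"
    using arg_cong[OF eq, of ev]
    by (simp add: ev.hom_add ev.hom_mult ev2_const[OF comm_ring_hom_emb])
  ultimately show thesis using that by blast
qed

lemma ev_nonzero: "B \<noteq> 0 \<Longrightarrow> degree B < q \<Longrightarrow> ev B \<noteq> 0"
  by (metis ev_norm ev1_nonzero mult_zero_right)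

lemma hermitian_poly_division:
  fixes A :: "'k poly poly"
  obtains Q R where "A = hermitian_poly q * Q + R" "degree R < q"
proof -
  obtain Q R where QR: "pseudo_divmod A (hermitian_poly q) = (Q, R)" by fastforce
  have h: "degree (hermitian_poly q :: 'k poly poly) = q" "(hermitian_poly q :: 'k poly poly) \<noteq> 0"
    "lead_coeff (hermitian_poly q :: 'k poly poly) = 1"
    using degree_hermitian_poly[OF q2, where 'k = 'k] by force+
  have "A = hermitian_poly q * Q + R" "degree R < q"
    using pseudo_divmod[OF h(2) QR] h q2 by auto
  then show thesis by (rule that)
qed

lemma ev_reduce:
  obtains R where "degree R < q" "ev R = ev A"
  by (rule hermitian_poly_division[of A]) (metis ev.hom_add ev.hom_mult ev_hermitian_poly add_0 mult_zero_left)

text \<open>Division by the monic Hermitian polynomial reduces to y-degree less than q, where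
  evaluation is injective. The kernel therefore depends only on q and the constants, not on the
  chosen \<open>x\<close> and \<open>y\<close>.\<close>

lemma ev_eq_0_iff: "ev A = 0 \<longleftrightarrow> hermitian_poly q dvd A"
proof
  obtain Q R where A: "A = hermitian_poly q * Q + R" "degree R < q"
    by (rule hermitian_poly_division[of A])
  assume "ev A = 0"
  then have "ev R = 0" by (simp add: A(1) ev.hom_add ev.hom_mult)
  then have "R = 0" using ev_nonzero A(2) by blast
  then show "hermitian_poly q dvd A" using A(1) by simp
next
  assume "hermitian_poly q dvd A"
  then show "ev A = 0" by (auto elim!: dvdE simp: ev.hom_mult)
qed

text \<open>The powers of y below q span \<open>F\<close> over k(x): multiplying by a cofactor turns
  the denominator into its norm, a polynomial in x alone.\<close>

lemma F_repE:
  assumes "f \<in> F"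
  obtains N A where "N \<noteq> 0" "degree A < q" "ev1 emb x N * f = ev A"
proof -
  obtain A B where AB: "ev B \<noteq> 0" "f = ev A / ev B" using F_quotientE[OF assms] .
  obtain B' where B': "degree B' < q" "ev B' = ev B" by (rule ev_reduce)
  then have "B' \<noteq> 0" using AB by auto
  then obtain U N where N: "N \<noteq> 0" "ev U * ev B' = ev1 emb x N"
    using ev_norm B' by blast
  obtain R where R: "degree R < q" "ev R = ev (A * U)" by (rule ev_reduce)
  have "ev1 emb x N * f = ev U * (ev B * f)"
    using N(2) B'(2) by (simp add: mult.assoc)
  also have "\<dots> = ev R" using AB R(2) by (simp add: ev.hom_mult)
  finally have "ev1 emb x N * f = ev R" .
  then show thesis using that N R by blast
qed

end

section \<open>Transfer to another model of the same function field\<close>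

locale hermitian_pair = hermitian_field emb q x y + other: hermitian_field emb' q x' y'
  for emb :: "'k::{field,finite} \<Rightarrow> 'f::field" and q x y and emb' :: "'k \<Rightarrow> 'g::field" and x' y'
begin

lemma ev_eq_0_iff': "other.ev A = 0 \<longleftrightarrow> ev A = 0"
  by (simp add: ev_eq_0_iff other.ev_eq_0_iff)

text \<open>The embedding of \<open>F\<close> that sends x and y to x' and y'. A quotient has many
  representations; since \<open>ev\<close> and \<open>other.ev\<close> have the same kernel, the
  result does not depend on the one chosen.\<close>

definition tr :: "'f \<Rightarrow> 'g" where
  "tr f = (THE z. \<exists>A B. ev B \<noteq> 0 \<and> f = ev A / ev B \<and> z = other.ev A / other.ev B)"

lemma tr_quotient:
  assumes "ev B \<noteq> 0"
  shows "tr (ev A / ev B) = other.ev A / other.ev B"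
  unfolding tr_def
proof (rule the_equality)
  fix z assume "\<exists>A' B'. ev B' \<noteq> 0 \<and> ev A / ev B = ev A' / ev B' \<and> z = other.ev A' / other.ev B'"
  then obtain A' B' where *: "ev B' \<noteq> 0" "ev A / ev B = ev A' / ev B'" "z = other.ev A' / other.ev B'"
    by blast
  then have "ev (A * B' - A' * B) = 0"
    using assms by (simp add: ev.hom_minus ev.hom_mult frac_eq_eq)
  then have "other.ev (A * B' - A' * B) = 0" by (simp add: ev_eq_0_iff')
  moreover have "other.ev B \<noteq> 0" "other.ev B' \<noteq> 0" using assms * by (simp_all add: ev_eq_0_iff')
  ultimately show "z = other.ev A / other.ev B"
    using * by (simp add: other.ev.hom_minus other.ev.hom_mult frac_eq_eq)
qed (use assms in blast)

lemma tr_ev: "tr (ev A) = other.ev A"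
  using tr_quotient[of 1 A] by simp

lemma tr_const [simp]: "tr (emb c) = emb' c"
  using tr_ev[of "[:[:c:]:]"] by simp

lemma tr_0 [simp]: "tr 0 = 0"
  using tr_ev[of 0] by simp

lemma tr_1 [simp]: "tr 1 = 1"
  using tr_ev[of 1] by simp

lemma tr_x [simp]: "tr x = x'"
  using tr_ev[of "[:[:0, 1:]:]"] by simp

lemma tr_y [simp]: "tr y = y'"
  using tr_ev[of "[:0, 1:]"] by simp

lemma tr_add: "f \<in> F \<Longrightarrow> g \<in> F \<Longrightarrow> tr (f + g) = tr f + tr g"
proof (elim F_quotientE)
  fix A B A' B' assume *: "ev B \<noteq> 0" "f = ev A / ev B" "ev B' \<noteq> 0" "g = ev A' / ev B'"
  then have "f + g = ev (A * B' + A' * B) / ev (B * B')" "ev (B * B') \<noteq> 0"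
    by (simp_all add: ev.hom_add ev.hom_mult add_frac_eq)
  then have "tr (f + g) = other.ev (A * B' + A' * B) / other.ev (B * B')"
    by (simp add: tr_quotient)
  then show ?thesis
    using * ev_eq_0_iff'[of B] ev_eq_0_iff'[of B']
    by (simp add: tr_quotient other.ev.hom_add other.ev.hom_mult add_frac_eq)
qed

lemma tr_mult: "f \<in> F \<Longrightarrow> g \<in> F \<Longrightarrow> tr (f * g) = tr f * tr g"
proof (elim F_quotientE)
  fix A B A' B' assume *: "ev B \<noteq> 0" "f = ev A / ev B" "ev B' \<noteq> 0" "g = ev A' / ev B'"
  then have "f * g = ev (A * A') / ev (B * B')" "ev (B * B') \<noteq> 0"
    by (simp_all add: ev.hom_mult)
  then have "tr (f * g) = other.ev (A * A') / other.ev (B * B')"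
    by (simp add: tr_quotient)
  then show ?thesis
    using * by (simp add: tr_quotient other.ev.hom_mult)
qed

lemma tr_eq_0_iff: "f \<in> F \<Longrightarrow> tr f = 0 \<longleftrightarrow> f = 0"
  by (elim F_quotientE) (auto simp: tr_quotient ev_eq_0_iff')

lemma tr_uminus: "f \<in> F \<Longrightarrow> tr (- f) = - tr f"
  using tr_add[of f "- f"] by (simp add: F_uminus add_eq_0_iff)

lemma tr_diff: "f \<in> F \<Longrightarrow> g \<in> F \<Longrightarrow> tr (f - g) = tr f - tr g"
  using tr_add[of f "- g"] by (simp add: F_uminus tr_uminus)

lemma tr_power: "f \<in> F \<Longrightarrow> tr (f ^ n) = tr f ^ n"
  by (induction n) (auto simp: tr_mult F_power)

end

section \<open>Places from Laurent series\<close>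

text \<open>A valuation pulled back from Laurent series might take only multiples of some
  \<open>d\<close>, whereas a place must be onto the integers; \<open>d\<close> is the factor to
  divide by.\<close>

lemma int_subgroup:
  fixes I :: "int set"
  assumes diff: "\<And>a b. a \<in> I \<Longrightarrow> b \<in> I \<Longrightarrow> a - b \<in> I" and "a \<in> I" "a \<noteq> 0"
  shows "\<exists>d>0. I = range ((*) d)"
proof -
  have zero: "0 \<in> I" using diff[of a a] \<open>a \<in> I\<close> by simp
  have uminus: "- b \<in> I" if "b \<in> I" for b using diff[OF zero that] by simp
  have add: "b + c \<in> I" if "b \<in> I" "c \<in> I" for b c using diff[OF that(1) uminus[OF that(2)]] by simp
  define d where "d = (LEAST n::nat. 0 < n \<and> int n \<in> I)"
  have "0 < nat \<bar>a\<bar> \<and> int (nat \<bar>a\<bar>) \<in> I"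
    using assms(2,3) uminus[of a] by (simp add: abs_if)
  then have d: "0 < d" "int d \<in> I"
    unfolding d_def by (metis (mono_tags, lifting) LeastI)+
  have mult_nat: "int d * int n \<in> I" for n
    by (induction n) (use zero add d in \<open>auto simp: algebra_simps\<close>)
  have mult: "int d * k \<in> I" for k
    using mult_nat[of "nat k"] uminus[OF mult_nat[of "nat (- k)"]] by (cases "0 \<le> k") auto
  have "b \<in> range ((*) (int d))" if "b \<in> I" for b
  proof -
    have "b mod int d \<in> I"
      using diff[OF that mult[of "b div int d"]] by (simp add: minus_mult_div_eq_mod)
    moreover have "\<not> (0 < n \<and> int n \<in> I)" if "n < d" for n
      using that not_less_Least unfolding d_def by blast
    moreover have "nat (b mod int d) < d"
      using d by (simp add: nat_less_iff)
    ultimately have "\<not> (0 < nat (b mod int d) \<and> int (nat (b mod int d)) \<in> I)" "b mod int d \<in> I"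
      by blast+
    moreover have "0 \<le> b mod int d" using d by simp
    ultimately have "b mod int d = 0" by simp
    then have "b = int d * (b div int d)" by (metis add_0_right mult_div_mod_eq)
    then show ?thesis by blast
  qed
  then show ?thesis using mult d by (intro exI[of _ "int d"]) auto
qed

lemma valuation_fls: "valuation UNIV (fls_subdegree :: 'a::field fls \<Rightarrow> int)"
proof
  fix a b :: "'a fls" assume "a + b \<noteq> 0"
  then show "min (fls_subdegree a) (fls_subdegree b) \<le> fls_subdegree (a + b)"
    using fls_subdegree_minus[of a "- b"] by simp
qed auto

interpretation fls: valuation UNIV "fls_subdegree :: 'a::field fls \<Rightarrow> int"
  by (rule valuation_fls)

abbreviation fls_emb :: "'k::field \<Rightarrow> 'k alg_closure fls" where
  "fls_emb c \<equiv> fls_const (to_ac c)"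

lemma field_hom_fls_emb: "field_hom (fls_emb :: 'k::field \<Rightarrow> 'k alg_closure fls)"
  by unfold_locales (auto simp: fls_plus_const)

lemma comm_ring_hom_fls_const: "comm_ring_hom (fls_const :: 'k::field \<Rightarrow> 'k fls)"
  by unfold_locales (auto simp: fls_plus_const)

text \<open>Over an algebraically closed field \<open>p\<close> splits into linear factors, and no
  \<open>z - e c\<close> vanishes. Transcendence of a Laurent series thus amounts to its not being
  constant.\<close>

lemma ev1_alg_closed_nonzero:
  fixes e :: "'k::alg_closed_field \<Rightarrow> 'l::idom"
  assumes "comm_ring_hom e" "\<And>c. z \<noteq> e c" "p \<noteq> 0"
  shows "ev1 e z p \<noteq> 0"
  using \<open>p \<noteq> 0\<close>
proof (induction "degree p" arbitrary: p)
  case 0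
  then obtain c where "p = [:c:]" "c \<noteq> 0" by (metis degree_eq_zeroE pCons_0_0)
  interpret e: comm_ring_hom e by fact
  have "e c * e (1 / c) = 1"
    using \<open>c \<noteq> 0\<close> by (simp flip: e.hom_mult)
  then show ?case using \<open>p = [:c:]\<close> by (auto simp: ev1_const[OF assms(1)])
next
  case (Suc n)
  interpret e: comm_ring_hom "ev1 e z" by (rule ev1_hom[OF assms(1)])
  obtain c where "poly p c = 0" using alg_closed_imp_poly_has_root[of p] Suc by auto
  then obtain r where r: "p = [:-c, 1:] * r" by (metis dvdE poly_eq_0_iff_dvd)
  then have "r \<noteq> 0" using Suc by auto
  then have "degree p = Suc (degree r)" by (simp add: r degree_mult_eq del: mult_pCons_left)
  then have "ev1 e z r \<noteq> 0" using Suc \<open>r \<noteq> 0\<close> by auto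
  moreover have "ev1 e z [:-c, 1:] = z - e c"
  proof -
    interpret e': comm_ring_hom e by fact
    show ?thesis using assms(1) by (simp add: ev1_pCons ev1_1 e'.hom_uminus)
  qed
  ultimately show ?case using assms(2) by (simp only: r e.hom_mult) simp
qed

lemma fls_transcendental:
  fixes z :: "'k::field alg_closure fls"
  assumes "\<And>c. z \<noteq> fls_const c" "p \<noteq> 0"
  shows "poly (map_poly fls_emb p) z \<noteq> 0"
proof -
  interpret inj_comm_ring_hom "to_ac :: 'k \<Rightarrow> 'k alg_closure" by unfold_locales auto
  have "map_poly to_ac p \<noteq> 0" using assms(2) by (simp add: map_poly_eq_0_iff)
  then have "ev1 fls_const z (map_poly to_ac p) \<noteq> 0"
    by (rule ev1_alg_closed_nonzero[OF comm_ring_hom_fls_const assms(1)])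
  then show ?thesis by (simp add: ev1_def map_poly_map_poly o_def)
qed

locale hermitian_laurent = hermitian_pair emb q x y fls_emb x' y'
  for emb :: "'k::{field,finite} \<Rightarrow> 'f::field" and q x y and x' y' :: "'k alg_closure fls"
begin

text \<open>The subdegree of the transferred element obeys the valuation laws on \<open>F\<close>.
  An element of nonzero value makes the value group nontrivial, and division by its generator
  \<open>d\<close> normalizes it.\<close>

lemma place_exists:
  assumes "f \<in> F" "fls_subdegree (tr f) \<noteq> 0"
  shows "\<exists>P\<in>places emb F. \<exists>d>0. \<forall>f\<in>F. f \<noteq> 0 \<longrightarrow> fls_subdegree (tr f) = d * P f"
proof -
  let ?W = "\<lambda>f. fls_subdegree (tr f)"
  have mult: "?W (a * b) = ?W a + ?W b" if "a \<in> F" "b \<in> F" "a \<noteq> 0" "b \<noteq> 0" for a b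
    using that by (simp add: tr_mult tr_eq_0_iff)
  have one: "?W 1 = 0" by simp
  have inv: "?W (inverse a) = - ?W a" if "a \<in> F" "a \<noteq> 0" for a
    using mult[of a "inverse a"] that one by (simp add: F_inverse)
  have "f \<noteq> 0" using assms(2) by auto
  have "\<exists>d>0. ?W ` (F - {0}) = range ((*) d)"
  proof (rule int_subgroup)
    fix a b assume "a \<in> ?W ` (F - {0})" "b \<in> ?W ` (F - {0})"
    then obtain g h where "g \<in> F" "g \<noteq> 0" "a = ?W g" "h \<in> F" "h \<noteq> 0" "b = ?W h" by blast
    then show "a - b \<in> ?W ` (F - {0})"
      by (intro image_eqI[of _ _ "g * inverse h"]) (auto simp: mult inv F_mult F_inverse)
  next
    show "?W f \<in> ?W ` (F - {0})" using assms \<open>f \<noteq> 0\<close> by blast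
  qed fact
  then obtain d where d: "d > 0" "?W ` (F - {0}) = range ((*) d)" by blast
  define P where "P = (\<lambda>f. if f \<in> F \<and> f \<noteq> 0 then ?W f div d else 0)"
  have WP: "?W f = d * P f" if "f \<in> F" "f \<noteq> 0" for f
  proof -
    have "?W f \<in> range ((*) d)" using that d(2) by blast
    then show ?thesis using that d(1) by (auto simp: P_def)
  qed
  have "P \<in> places emb F"
    unfolding places_def
  proof (intro CollectI conjI ballI allI impI)
    show "P f = 0" if "f \<notin> F \<or> f = 0" for f using that by (auto simp: P_def)
    show "P (emb c) = 0" for c by (simp add: P_def)
    show "P (f * g) = P f + P g" if "f \<in> F - {0}" "g \<in> F - {0}" for f g
    proof -
      have "d * P (f * g) = d * (P f + P g)"
        using that WP[of f] WP[of g] WP[of "f * g"] mult[of f g] by (simp add: F_mult distrib_left)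
      then show ?thesis using d(1) by simp
    qed
    show "min (P f) (P g) \<le> P (f + g)" if "f \<in> F - {0}" "g \<in> F - {0}" "f + g \<noteq> 0" for f g
    proof -
      have "min (?W f) (?W g) \<le> ?W (f + g)"
        using that fls.v_add[of "tr f" "tr g"] tr_eq_0_iff[of f] tr_eq_0_iff[of g] tr_eq_0_iff[of "f + g"]
        by (simp add: tr_add F_add)
      then have "min (d * P f) (d * P g) \<le> d * P (f + g)"
        using that WP[of f] WP[of g] WP[of "f + g"] by (simp add: F_add)
      then show ?thesis using d(1) by (auto simp: min_def split: if_splits)
    qed
    show "P ` (F - {0}) = UNIV"
    proof -
      have "k \<in> P ` (F - {0})" for k
      proof -
        have "d * k \<in> ?W ` (F - {0})" using d(2) by blast
        then obtain f where "f \<in> F" "f \<noteq> 0" "d * k = ?W f" by blast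
        then have "k = P f" using WP[of f] d(1) by simp
        then show ?thesis using \<open>f \<in> F\<close> \<open>f \<noteq> 0\<close> by blast
      qed
      then show ?thesis by blast
    qed
  qed
  then show ?thesis using WP d(1) by blast
qed

end

text \<open>The power series solution \<open>w\<close> of \<open>w\<^sup>q + w = (\<alpha> + t)\<^sup>q\<^sup>+\<^sup>1 - \<alpha>\<^sup>q\<^sup>+\<^sup>1\<close> vanishing at \<open>t = 0\<close>.\<close>

definition branch :: "nat \<Rightarrow> 'a::field \<Rightarrow> 'a fps" where
  "branch q \<alpha> = fps_inv (fps_X + fps_X ^ q) oo ((fps_const \<alpha> + fps_X) ^ (q + 1) - fps_const (\<alpha> ^ (q + 1)))"

lemma branch_0 [simp]: "branch q \<alpha> $ 0 = 0"
  by (simp add: branch_def fps_inv_def)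

lemma branch_eq:
  assumes "2 \<le> q"
  shows "branch q \<alpha> ^ q + branch q \<alpha> = (fps_const \<alpha> + fps_X) ^ (q + 1) - fps_const (\<alpha> ^ (q + 1))"
proof -
  let ?g = "fps_X + fps_X ^ q :: 'a fps"
  let ?c = "(fps_const \<alpha> + fps_X) ^ (q + 1) - fps_const (\<alpha> ^ (q + 1)) :: 'a fps"
  have c0: "?c $ 0 = 0" by (simp add: fps_power_zeroth del: power_Suc)
  have g: "?g $ 0 = 0" "?g $ 1 \<noteq> 0" using assms by (simp_all add: fps_X_power_nth)
  have "branch q \<alpha> ^ q + branch q \<alpha> = ?g oo branch q \<alpha>"
    by (simp add: fps_compose_add_distrib fps_compose_power[symmetric])
  also have "\<dots> = (?g oo fps_inv ?g) oo ?c"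
    unfolding branch_def by (rule fps_compose_assoc[OF c0]) (simp add: fps_inv_def)
  also have "\<dots> = ?c"
    using fps_inv_right[OF g] c0 by simp
  finally show ?thesis .
qed

context hermitian_field
begin

lemma prime_CHAR: "prime CHAR('k)"
  by (intro prime_CHAR_semidom finite_imp_CHAR_pos) simp

lemma CHAR_power:
  assumes "primepow q" "card (UNIV :: 'k set) = q\<^sup>2"
  shows "\<exists>n. q = CHAR('k) ^ n"
proof -
  obtain p n where p: "prime p" "0 < n" "q = p ^ n"
    using assms(1) by (auto simp: primepow_def)
  have "CHAR('k) dvd p ^ (2 * n)"
    using CHAR_dvd_CARD[where 'a = 'k] assms(2) p(3) by (simp add: power_mult[symmetric] mult.commute)
  moreover have "prime CHAR('k)"
    by (rule prime_CHAR)
  ultimately show ?thesis using p(1,3) by (metis prime_dvd_power primes_dvd_imp_eq)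
qed

end

section \<open>Branches of the curve over the algebraic closure\<close>

locale hermitian_square = hermitian_field emb q x y
  for emb :: "'k::{field,finite} \<Rightarrow> 'f::field" and q x y +
  assumes primepow_q: "primepow q" and card_UNIV: "card (UNIV :: 'k set) = q\<^sup>2"
begin

lemma frobenius_k: "(a + b) ^ q = a ^ q + b ^ q" for a b :: 'k
  using CHAR_power[OF primepow_q card_UNIV] freshmans_dream'[where x = a and y = b and m = q] prime_CHAR by auto

lemma frobenius_ac: "(a + b) ^ q = a ^ q + b ^ q" for a b :: "'k alg_closure"
  using CHAR_power[OF primepow_q card_UNIV] freshmans_dream'[where x = a and y = b and m = q] prime_CHAR by auto

lemma frobenius_fls: "(a + b) ^ q = a ^ q + b ^ q" for a b :: "'k alg_closure fls"
  using CHAR_power[OF primepow_q card_UNIV] freshmans_dream'[where x = a and y = b and m = q] prime_CHAR by auto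

text \<open>The parametrization x = \<alpha> + t. It works at every finite point because the
  derivative of y^q + y with respect to y is 1.\<close>

definition x_at :: "'k alg_closure \<Rightarrow> 'k alg_closure fls" where
  "x_at \<alpha> = fps_to_fls (fps_const \<alpha> + fps_X)"

definition y_at :: "'k alg_closure \<Rightarrow> 'k alg_closure \<Rightarrow> 'k alg_closure fls" where
  "y_at \<alpha> \<beta> = fps_to_fls (fps_const \<beta> + branch q \<alpha>)"

lemma laurent_at:
  assumes "\<beta> ^ q + \<beta> = \<alpha> ^ (q + 1)"
  shows "hermitian_laurent emb q x y (x_at \<alpha>) (y_at \<alpha> \<beta>)"
proof -
  interpret e: field_hom "fls_emb :: 'k \<Rightarrow> _" by (rule field_hom_fls_emb)
  have "hermitian_function_field (fls_emb :: 'k \<Rightarrow> _) q (x_at \<alpha>) (y_at \<alpha> \<beta>)"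
  proof
    fix p :: "'k poly" assume "p \<noteq> 0"
    have "x_at \<alpha> \<noteq> fls_const c" for c
      unfolding x_at_def
    proof
      assume "fps_to_fls (fps_const \<alpha> + fps_X) = fls_const c"
      then have "fls_nth (fps_to_fls (fps_const \<alpha> + fps_X)) 1 = fls_nth (fls_const c) 1" by simp
      then show False by simp
    qed
    then show "poly (map_poly fls_emb p) (x_at \<alpha>) \<noteq> 0"
      using \<open>p \<noteq> 0\<close> by (intro fls_transcendental)
  next
    \<comment> \<open>Additivity of the q-th power separates the constant \<beta> from the branch,
      so the two equations simply add up.\<close>
    have "y_at \<alpha> \<beta> ^ q = fls_const (\<beta> ^ q) + fps_to_fls (branch q \<alpha>) ^ q"
      unfolding y_at_def by (simp add: frobenius_fls fls_const_power flip: fps_to_fls_power)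
    then have "y_at \<alpha> \<beta> ^ q + y_at \<alpha> \<beta> = fls_const (\<beta> ^ q + \<beta>) + fps_to_fls (branch q \<alpha> ^ q + branch q \<alpha>)"
      unfolding y_at_def by (simp add: fps_to_fls_power fls_plus_const algebra_simps)
    also have "\<dots> = x_at \<alpha> ^ (q + 1)"
      unfolding branch_eq[OF q2] assms x_at_def
      by (simp add: fps_to_fls_power fls_times_fps_to_fls fls_const_power del: power_Suc)
    finally show "y_at \<alpha> \<beta> ^ q + y_at \<alpha> \<beta> = x_at \<alpha> ^ (q + 1)" .
  qed
  then show ?thesis
    using q2 card_gt hermitian_field_axioms
    by (simp add: hermitian_laurent_def hermitian_pair_def hermitian_field_def hermitian_field_axioms_def)
qed

text \<open>With t = x/y and z = 1/y, division of the curve equation by y^(q+1) gives z^q + z =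
  t^(q+1), the equation solved by the branch at 0. At infinity, then, x = t/z and y = 1/z.\<close>

definition z_inf :: "'k alg_closure fls" where
  "z_inf = fps_to_fls (branch q 0)"

lemma z_inf_eq: "z_inf ^ q + z_inf = fls_X ^ (q + 1)"
proof -
  have "branch q 0 ^ q + branch q 0 = (fps_X :: 'k alg_closure fps) ^ (q + 1)"
    using branch_eq[OF q2, of "0 :: 'k alg_closure"] by simp
  then have "fps_to_fls (branch q 0 ^ q + branch q 0) = fps_to_fls ((fps_X :: 'k alg_closure fps) ^ (q + 1))"
    by (rule arg_cong)
  then show ?thesis by (simp add: z_inf_def fps_to_fls_power fls_times_fps_to_fls del: power_Suc)
qed

lemma z_inf_nonzero: "z_inf \<noteq> 0"
proof
  assume "z_inf = 0"
  then have "fls_X ^ (q + 1) = (0 :: 'k alg_closure fls)" using z_inf_eq q2 by (simp add: power_0_left)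
  then show False by simp
qed

text \<open>z^q has larger order than z, so z alone must match the order of t^(q+1). The resulting
  pole orders q and q + 1 of x and y are the weights in \<open>v_ev2\<close>.\<close>

lemma subdegree_z_inf: "fls_subdegree z_inf = int (q + 1)"
proof -
  have "branch q (0 :: 'k alg_closure) \<noteq> 0" using z_inf_nonzero by (auto simp: z_inf_def)
  then have "fls_subdegree z_inf > 0"
    unfolding z_inf_def fls_subdegree_fls_to_fps of_nat_0_less_iff
    by (intro gr0I) (simp add: subdegree_eq_0_iff)
  then have "fls_subdegree z_inf < fls_subdegree (z_inf ^ q)"
    using q2 z_inf_nonzero by (simp add: fls.v_power)
  then have "fls_subdegree (z_inf ^ q + z_inf) = fls_subdegree z_inf"
    using fls.v_add_strict[of z_inf "z_inf ^ q"] z_inf_nonzero by (simp add: add.commute)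
  then show ?thesis unfolding z_inf_eq by (simp add: fls.v_power del: power_Suc)
qed

definition x_inf :: "'k alg_closure fls" where "x_inf = fls_X / z_inf"
definition y_inf :: "'k alg_closure fls" where "y_inf = 1 / z_inf"

lemma subdegree_x_inf: "fls_subdegree x_inf = - int q"
  and subdegree_y_inf: "fls_subdegree y_inf = - int (q + 1)"
proof -
  have "fls_subdegree (x_inf * z_inf) = fls_subdegree (fls_X :: 'k alg_closure fls)"
    "fls_subdegree (y_inf * z_inf) = fls_subdegree (1 :: 'k alg_closure fls)"
    using z_inf_nonzero by (simp_all add: x_inf_def y_inf_def)
  moreover have "x_inf \<noteq> 0" "y_inf \<noteq> 0" using z_inf_nonzero by (simp_all add: x_inf_def y_inf_def)
  ultimately show "fls_subdegree x_inf = - int q" "fls_subdegree y_inf = - int (q + 1)"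
    using subdegree_z_inf z_inf_nonzero by simp_all
qed

lemma laurent_inf: "hermitian_laurent emb q x y x_inf y_inf"
proof -
  interpret e: field_hom "fls_emb :: 'k \<Rightarrow> _" by (rule field_hom_fls_emb)
  have "hermitian_function_field (fls_emb :: 'k \<Rightarrow> _) q x_inf y_inf"
  proof
    fix p :: "'k poly" assume "p \<noteq> 0"
    have "x_inf \<noteq> fls_const c" for c
      using subdegree_x_inf q2 by auto
    then show "poly (map_poly fls_emb p) x_inf \<noteq> 0"
      using \<open>p \<noteq> 0\<close> by (intro fls_transcendental)
  next
    have "y_inf ^ q + y_inf = (z_inf ^ q + z_inf) / z_inf ^ (q + 1)"
      using z_inf_nonzero by (simp add: y_inf_def field_simps)
    also have "\<dots> = x_inf ^ (q + 1)"
      by (simp only: z_inf_eq x_inf_def power_divide)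
    finally show "y_inf ^ q + y_inf = x_inf ^ (q + 1)" .
  qed
  then show ?thesis
    using q2 card_gt hermitian_field_axioms
    by (simp add: hermitian_laurent_def hermitian_pair_def hermitian_field_def hermitian_field_axioms_def)
qed

end

section \<open>Functions regular at all finite points\<close>

context valuation
begin

text \<open>The valuation ring; \<open>small\<close> below is its maximal ideal. Both list 0
  separately because \<open>v 0\<close> carries no information.\<close>

definition integral :: "'l \<Rightarrow> bool" where "integral a \<longleftrightarrow> a \<in> S \<and> (a = 0 \<or> 0 \<le> v a)"
definition small :: "'l \<Rightarrow> bool" where "small a \<longleftrightarrow> a \<in> S \<and> (a = 0 \<or> 0 < v a)"

lemma integral_add: "integral a \<Longrightarrow> integral b \<Longrightarrow> integral (a + b)"
  using v_add[of a b] by (cases "a = 0"; cases "b = 0"; cases "a + b = 0") (auto simp: integral_def)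

lemma integral_mult: "integral a \<Longrightarrow> integral b \<Longrightarrow> integral (a * b)"
  using v_mult[of a b] by (cases "a = 0"; cases "b = 0") (auto simp: integral_def)

lemma small_add: "small a \<Longrightarrow> small b \<Longrightarrow> small (a + b)"
  using v_add[of a b] by (cases "a = 0"; cases "b = 0"; cases "a + b = 0") (auto simp: small_def)

lemma small_uminus: "small a \<Longrightarrow> small (- a)"
  by (auto simp: small_def v_uminus)

lemma small_diff: "small a \<Longrightarrow> small b \<Longrightarrow> small (a - b)"
  using small_add[of a "- b"] small_uminus[of b] by simp

lemma small_mult: "small a \<Longrightarrow> integral b \<Longrightarrow> small (a * b)"
  using v_mult[of a b] by (cases "a = 0"; cases "b = 0") (auto simp: integral_def small_def)

lemma small_imp_integral: "small a \<Longrightarrow> integral a"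
  by (auto simp: integral_def small_def)

lemma v_add_small: "small a \<Longrightarrow> b \<in> S \<Longrightarrow> b \<noteq> 0 \<Longrightarrow> v b = 0 \<Longrightarrow> b + a \<noteq> 0 \<and> v (b + a) = 0"
  using v_add_strict[of b a] by (cases "a = 0") (auto simp: small_def)

end

context hermitian_function_field
begin

lemma valuation_place:
  assumes "P \<in> places emb F"
  shows "valuation F P"
  using assms unfolding places_def by unfold_locales (auto intro: F_intros)

lemma place_emb: "P \<in> places emb F \<Longrightarrow> P (emb c) = 0"
  by (auto simp: places_def)

lemma place_outside: "P \<in> places emb F \<Longrightarrow> f \<notin> F \<or> f = 0 \<Longrightarrow> P f = 0"
  by (auto simp: places_def)

lemma place_surj: "P \<in> places emb F \<Longrightarrow> \<exists>f\<in>F. f \<noteq> 0 \<and> P f = k"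
proof -
  assume "P \<in> places emb F"
  then have "k \<in> P ` (F - {0})" by (auto simp: places_def)
  then show ?thesis by blast
qed

lemma place_eqI:
  assumes "P \<in> places emb F" "P' \<in> places emb F" "\<And>f. f \<in> F \<Longrightarrow> f \<noteq> 0 \<Longrightarrow> P f = P' f"
  shows "P = P'"
proof
  fix f show "P f = P' f"
    using assms(3)[of f] place_outside[OF assms(1), of f] place_outside[OF assms(2), of f] by metis
qed

lemma x_minus_const_nonzero: "x - emb c \<noteq> 0"
  using ev1_nonzero[of "[:-c, 1:]"] by (simp add: ev1_pCons comm_ring_hom_emb ev1_1 hom_uminus)

lemma x_nonzero: "x \<noteq> 0"
  using x_minus_const_nonzero[of 0] by simp

end

lemma comm_ring_hom_id: "comm_ring_hom (\<lambda>c :: 'a::comm_ring_1. c)"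
  by unfold_locales auto

lemma comm_ring_hom_to_ac: "comm_ring_hom (to_ac :: 'k::field \<Rightarrow> 'k alg_closure)"
  by unfold_locales auto

text \<open>The ideal of the point (a, b) is generated by x - a and y - b: substituting b for y
  leaves a polynomial in x, from which the value at a is then split off.\<close>

lemma ev2_ideal_decomposition:
  fixes A :: "'k::field poly poly"
  obtains A1 A2 where
    "A = [:[:ev2 (\<lambda>c. c) a b A:]:] + [:[:-a, 1:]:] * [:A1:] + [:- [:b:], 1:] * A2"
proof -
  let ?r = "poly A [:b:]"
  have r: "poly ?r a = ev2 (\<lambda>c. c) a b A"
    by (induction A) (simp_all add: ev2_pCons ev1_def comm_ring_hom_id ev2_def)
  have "[:- [:b:], 1:] dvd A - [:?r:]" by (subst poly_eq_0_iff_dvd[symmetric]) simp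
  then obtain A2 where A2: "A - [:?r:] = [:- [:b:], 1:] * A2" by (elim dvdE)
  have "[:-a, 1:] dvd ?r - [:ev2 (\<lambda>c. c) a b A:]" by (simp add: r flip: poly_eq_0_iff_dvd)
  then obtain A1 where A1: "?r - [:ev2 (\<lambda>c. c) a b A:] = [:-a, 1:] * A1" by (elim dvdE)
  have "[:?r:] = [:[:ev2 (\<lambda>c. c) a b A:]:] + [:?r - [:ev2 (\<lambda>c. c) a b A:]:]" by simp
  also have "\<dots> = [:[:ev2 (\<lambda>c. c) a b A:]:] + [:[:-a, 1:]:] * [:A1:]" unfolding A1 by simp
  finally have "A = [:[:ev2 (\<lambda>c. c) a b A:]:] + [:[:-a, 1:]:] * [:A1:] + [:- [:b:], 1:] * A2"
    using A2 by (metis diff_add_cancel add.commute)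
  then show thesis by (rule that)
qed

lemma power_card_UNIV:
  fixes b :: "'a::{field,finite}"
  shows "b ^ card (UNIV :: 'a set) = b"
proof (cases "b = 0")
  case False
  have "(\<Prod>z\<in>UNIV - {0}. b * z) = (\<Prod>z\<in>UNIV - {0}. z)"
    by (rule prod.reindex_bij_witness[of _ "\<lambda>z. z / b" "\<lambda>z. b * z"]) (use False in auto)
  then have "b ^ card (UNIV - {0 :: 'a}) * (\<Prod>z\<in>UNIV - {0}. z) = 1 * (\<Prod>z\<in>UNIV - {0}. z)"
    by (simp only: prod.distrib prod_constant mult_1)
  moreover have "(\<Prod>z\<in>UNIV - {0 :: 'a}. z) \<noteq> 0"
    by simp
  ultimately have "b ^ card (UNIV - {0 :: 'a}) = 1"
    by (metis mult_right_cancel)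
  moreover have "Suc (card (UNIV - {0 :: 'a})) = card (UNIV :: 'a set)"
    by (rule card_Suc_Diff1) simp_all
  ultimately show ?thesis by (metis power_Suc mult_1_right)
qed (simp add: power_0_left)

section \<open>Orders at points over the algebraic closure\<close>

context hermitian_square
begin

text \<open>Coordinates in the closure are allowed because a finite place of higher degree has no
  centre with coordinates in \<open>'k\<close>.\<close>

definition ord_at :: "'k alg_closure \<Rightarrow> 'k alg_closure \<Rightarrow> 'f \<Rightarrow> int" where
  "ord_at \<alpha> \<beta> f = fls_subdegree (hermitian_pair.tr emb x y fls_emb (x_at \<alpha>) (y_at \<alpha> \<beta>) f)"

text \<open>Polynomials in x and y expand without a pole, and the constant coefficient is the value
  at the point because the branch vanishes at t = 0.\<close>

lemma ev2_at:
  obtains s where "ev2 fls_emb (x_at \<alpha>) (y_at \<alpha> \<beta>) A = fps_to_fls s" "fps_nth s 0 = ev2 to_ac \<alpha> \<beta> A"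
proof -
  let ?e = "\<lambda>c :: 'k. fps_const (to_ac c)"
  have e: "comm_ring_hom ?e" by unfold_locales auto
  have h: "comm_ring_hom (fps_to_fls :: 'k alg_closure fps \<Rightarrow> _)"
    by unfold_locales (auto simp: fls_times_fps_to_fls)
  have n: "comm_ring_hom (\<lambda>s :: 'k alg_closure fps. fps_nth s 0)"
    by unfold_locales auto
  let ?s = "ev2 ?e (fps_const \<alpha> + fps_X) (fps_const \<beta> + branch q \<alpha>) A"
  have "fps_to_fls ?s = ev2 fls_emb (x_at \<alpha>) (y_at \<alpha> \<beta>) A"
    unfolding ev2_comp[OF e h] x_at_def y_at_def by simp
  moreover have "fps_nth ?s 0 = ev2 to_ac \<alpha> \<beta> A"
    unfolding ev2_comp[OF e n] by simp
  ultimately show thesis using that by metis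
qed

lemma ord_at_ev:
  assumes "\<beta> ^ q + \<beta> = \<alpha> ^ (q + 1)" "ev A \<noteq> 0"
  shows "0 \<le> ord_at \<alpha> \<beta> (ev A)" "0 < ord_at \<alpha> \<beta> (ev A) \<longleftrightarrow> ev2 to_ac \<alpha> \<beta> A = 0"
proof -
  interpret L: hermitian_laurent emb q x y "x_at \<alpha>" "y_at \<alpha> \<beta>" by (rule laurent_at[OF assms(1)])
  obtain s where s: "L.other.ev A = fps_to_fls s" "fps_nth s 0 = ev2 to_ac \<alpha> \<beta> A" by (rule ev2_at)
  have "s \<noteq> 0" using assms(2) s(1) by (auto simp: L.ev_eq_0_iff'[symmetric])
  then show "0 \<le> ord_at \<alpha> \<beta> (ev A)" "0 < ord_at \<alpha> \<beta> (ev A) \<longleftrightarrow> ev2 to_ac \<alpha> \<beta> A = 0"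
    using s by (auto simp: ord_at_def L.tr_ev fls_subdegree_fls_to_fps subdegree_eq_0_iff
      simp flip: neq0_conv)
qed

lemma ord_at_mult:
  assumes "\<beta> ^ q + \<beta> = \<alpha> ^ (q + 1)" "f \<in> F" "g \<in> F" "f \<noteq> 0" "g \<noteq> 0"
  shows "ord_at \<alpha> \<beta> (f * g) = ord_at \<alpha> \<beta> f + ord_at \<alpha> \<beta> g"
proof -
  interpret L: hermitian_laurent emb q x y "x_at \<alpha>" "y_at \<alpha> \<beta>" by (rule laurent_at[OF assms(1)])
  show ?thesis using assms by (simp add: ord_at_def L.tr_mult L.tr_eq_0_iff)
qed

text \<open>The kernel of the trace from the field with q^2 elements to the one with q. Its elements
  are the y-coordinates of the points over x = 0, and its translates are the other fibres of
  x.\<close>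

definition trace_kernel :: "'k set" where "trace_kernel = {b. b ^ q + b = 0}"

lemma card_roots_le:
  "finite {z :: 'a::field. z ^ q + z = c}" "card {z :: 'a::field. z ^ q + z = c} \<le> q"
proof -
  let ?p = "monom 1 q + (monom 1 1 - [:c:]) :: 'a poly"
  have "degree (monom 1 1 - [:c:]) \<le> 1" by (intro degree_diff_le) (auto simp: degree_monom_eq)
  then have d: "degree ?p = q"
    using q2 by (subst degree_add_eq_left) (auto simp: degree_monom_eq)
  then have p: "?p \<noteq> 0" using q2 by force
  have eq: "{z. z ^ q + z = c} = {z. poly ?p z = 0}"
    by (auto simp: poly_monom algebra_simps)
  show "finite {z. z ^ q + z = c}" unfolding eq by (rule poly_roots_finite[OF p])
  show "card {z. z ^ q + z = c} \<le> q" unfolding eq using card_poly_roots_bound[OF p] d by simp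
qed

text \<open>Rank and nullity by counting: the trace takes its values among the at most q roots of
  c^q = c, so its kernel has at least q^2 / q elements.\<close>

lemma card_trace_kernel: "card trace_kernel = q"
proof (rule antisym)
  show "card trace_kernel \<le> q" unfolding trace_kernel_def by (rule card_roots_le)
  let ?T = "\<lambda>b :: 'k. b ^ q + b"
  have fixed: "?T b ^ q = ?T b" for b
  proof -
    have "(b ^ q) ^ q = b"
      using power_card_UNIV[of b] card_UNIV
      by (simp add: power2_eq_square flip: power_mult)
    then show ?thesis by (simp add: frobenius_k add.commute)
  qed
  have "card (range ?T) \<le> card {c :: 'k. poly (monom 1 q - monom 1 1) c = 0}"
  proof (rule card_mono)
    have "monom 1 q - monom 1 1 \<noteq> (0 :: 'k poly)"
    proof
      assume "monom 1 q - monom 1 1 = (0 :: 'k poly)"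
      then have "degree (monom 1 q :: 'k poly) = degree (monom 1 1 :: 'k poly)" by simp
      then show False using q2 by (simp add: degree_monom_eq)
    qed
    then show "finite {c :: 'k. poly (monom 1 q - monom 1 1) c = 0}" by (rule poly_roots_finite)
  qed (use fixed in \<open>auto simp: poly_monom\<close>)
  also have "\<dots> \<le> q"
  proof -
    have d: "degree (monom 1 q + - monom 1 1 :: 'k poly) = q"
      using q2 by (subst degree_add_eq_left) (auto simp: degree_monom_eq)
    then have "monom 1 q - monom 1 1 \<noteq> (0 :: 'k poly)" using q2 by force
    from card_poly_roots_bound[OF this] d show ?thesis by simp
  qed
  finally have range: "card (range ?T) \<le> q" .
  \<comment> \<open>\<open>s\<close> chooses a preimage of each trace value. An element
    \<open>b\<close> is recovered from its trace together with \<open>b - s (?T b)\<close>, which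
    lies in the kernel.\<close>
  define s where "s = (\<lambda>c. SOME b. ?T b = c)"
  have s: "?T (s (?T b)) = ?T b" for b unfolding s_def by (rule someI[of _ b]) simp
  have minus: "(- b) ^ q = - (b ^ q)" for b :: 'k
    using frobenius_k[of b "- b"] q2 by (simp add: add_eq_0_iff power_0_left)
  have "card (UNIV :: 'k set) \<le> card (range ?T \<times> trace_kernel)"
  proof (rule card_inj_on_le)
    show "inj_on (\<lambda>b. (?T b, b - s (?T b))) UNIV" by (auto simp: inj_on_def)
    have "?T (b - s (?T b)) = 0" for b
    proof -
      have "?T (b - s (?T b)) = ?T b - ?T (s (?T b))"
        using frobenius_k[of b "- s (?T b)"] minus[of "s (?T b)"] by simp
      then show ?thesis using s[of b] by simp
    qed
    then show "range (\<lambda>b. (?T b, b - s (?T b))) \<subseteq> range ?T \<times> trace_kernel"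
      by (auto simp: trace_kernel_def)
  qed simp
  also have "\<dots> \<le> q * card trace_kernel"
    using range by (simp add: card_cartesian_product)
  finally show "q \<le> card trace_kernel"
    using card_UNIV q2 by (simp add: power2_eq_square)
qed

text \<open>Translation by the kernel preserves the fibre, and the q translates already exhaust the
  at most q roots. Every fibre over the affine line thus has q distinct points.\<close>

lemma roots_above:
  fixes \<alpha> :: "'k alg_closure"
  assumes "\<beta> ^ q + \<beta> = \<alpha> ^ (q + 1)"
  shows "{z. z ^ q + z = \<alpha> ^ (q + 1)} = (\<lambda>b. \<beta> + to_ac b) ` trace_kernel"
proof (rule sym, rule card_subset_eq)
  show sub: "(\<lambda>b. \<beta> + to_ac b) ` trace_kernel \<subseteq> {z. z ^ q + z = \<alpha> ^ (q + 1)}"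
  proof clarify
    fix b assume "b \<in> trace_kernel"
    then have "to_ac b ^ q + to_ac b = 0"
      by (simp add: trace_kernel_def flip: to_ac_power to_ac_add)
    then show "(\<beta> + to_ac b) ^ q + (\<beta> + to_ac b) = \<alpha> ^ (q + 1)"
      using assms frobenius_ac[of \<beta> "to_ac b"] by (simp add: algebra_simps)
  qed
  have "card ((\<lambda>b. \<beta> + to_ac b) ` trace_kernel) = q"
    by (subst card_image) (auto simp: inj_on_def card_trace_kernel)
  then show "card ((\<lambda>b. \<beta> + to_ac b) ` trace_kernel) = card {z. z ^ q + z = \<alpha> ^ (q + 1)}"
    using card_mono[OF card_roots_le(1) sub] card_roots_le(2)[of "\<alpha> ^ (q + 1)"] by simp
qed (rule card_roots_le)

lemma exists_above:
  fixes \<alpha> :: "'k alg_closure"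
  shows "\<exists>\<beta>. \<beta> ^ q + \<beta> = \<alpha> ^ (q + 1)"
proof -
  let ?c = "\<alpha> ^ (q + 1)"
  let ?p = "monom 1 q + (monom 1 1 - [:?c:])"
  have "degree (monom 1 1 - [:?c:]) \<le> 1" by (intro degree_diff_le) (auto simp: degree_monom_eq)
  then have "degree ?p = q"
    using q2 by (subst degree_add_eq_left) (auto simp: degree_monom_eq)
  then obtain \<beta> where "poly ?p \<beta> = 0" using alg_closed_imp_poly_has_root[of ?p] q2 by auto
  then show ?thesis by (intro exI[of _ \<beta>]) (simp add: poly_monom algebra_simps)
qed

lemma regular_imp_polynomial:
  assumes "g \<in> F" "g \<noteq> 0"
    and reg: "\<And>\<alpha> \<beta>. \<beta> ^ q + \<beta> = \<alpha> ^ (q + 1) \<Longrightarrow> 0 \<le> ord_at \<alpha> \<beta> g"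
  obtains A where "degree A < q" "g = ev A"
proof -
  \<comment> \<open>Among the denominators that are polynomials in x, one of least degree is taken;
    it will turn out to be constant.\<close>
  let ?P = "\<lambda>N. N \<noteq> 0 \<and> (\<exists>A. degree A < q \<and> ev1 emb x N * g = ev A)"
  obtain N0 where "?P N0" using F_repE[OF assms(1)] by blast
  from ex_has_least_nat[of ?P, OF this, of degree]
  obtain N where N: "?P N" and min: "\<And>M. ?P M \<Longrightarrow> degree N \<le> degree M" by blast
  obtain A where A: "degree A < q" "ev1 emb x N * g = ev A" using N by blast
  have "degree N = 0"
  proof (rule ccontr)
    interpret t: inj_comm_ring_hom "to_ac :: 'k \<Rightarrow> 'k alg_closure" by unfold_locales auto
    assume "degree N \<noteq> 0"
    then obtain \<alpha> where \<alpha>: "ev1 to_ac \<alpha> N = 0"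
      using alg_closed_imp_poly_has_root[of "map_poly to_ac N"] by (auto simp: ev1_def)
    interpret E: comm_ring_hom "ev1 to_ac \<alpha> :: 'k poly \<Rightarrow> _" by (rule ev1_hom[OF comm_ring_hom_to_ac])
    let ?Q = "\<lambda>p :: 'k poly. p \<noteq> 0 \<and> ev1 to_ac \<alpha> p = 0"
    \<comment> \<open>A minimal polynomial of \<alpha> over the constants. It turns vanishing at
      \<alpha> into divisibility over \<open>'k\<close>, so that a common factor can be cancelled
      there.\<close>
    obtain p where p: "?Q p" and pmin: "\<And>r. ?Q r \<Longrightarrow> degree p \<le> degree r"
      using ex_has_least_nat[of ?Q N degree] N \<alpha> by auto
    have pdvd: "p dvd r" if "ev1 to_ac \<alpha> r = 0" for r
    proof -
      have "ev1 to_ac \<alpha> (p * (r div p) + r mod p) = 0" using that by simp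
      then have "ev1 to_ac \<alpha> (r mod p) = 0" using p by (simp only: E.hom_add E.hom_mult) simp
      then have "r mod p = 0"
        using pmin[of "r mod p"] degree_mod_less[of p r] p by force
      then show ?thesis by auto
    qed
    have "degree p \<noteq> 0"
    proof
      assume "degree p = 0"
      then obtain c where "p = [:c:]" by (elim degree_eq_zeroE)
      then show False using p by (simp add: ev1_const[OF comm_ring_hom_to_ac])
    qed
    let ?a = "map_poly (ev1 to_ac \<alpha>) A"
    \<comment> \<open>N(x) has a zero at each point above \<alpha> and g has no pole there, so their
      product, the image of \<open>A\<close>, vanishes too.\<close>
    have "ev2 to_ac \<alpha> \<beta> A = 0" if \<beta>: "\<beta> ^ q + \<beta> = \<alpha> ^ (q + 1)" for \<beta>
    proof (cases "ev A = 0")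
      case True
      then show ?thesis using A N ev1_nonzero[of N] assms(2) by auto
    next
      case False
      have N': "ev1 emb x N = ev [:N:]" by (simp add: ev2_const[OF comm_ring_hom_emb])
      have "0 < ord_at \<alpha> \<beta> (ev [:N:])"
        using ord_at_ev(2)[OF \<beta>, of "[:N:]"] N \<alpha> ev1_nonzero[of N]
        by (simp add: ev2_const[OF comm_ring_hom_emb] ev2_const[OF comm_ring_hom_to_ac])
      moreover have "ord_at \<alpha> \<beta> (ev A) = ord_at \<alpha> \<beta> (ev [:N:]) + ord_at \<alpha> \<beta> g"
        using A(2) N ev1_nonzero[of N] assms(1,2) ord_at_mult[OF \<beta>, of "ev [:N:]" g] ev1_in_F by (simp flip: N')
      ultimately show ?thesis using reg[OF \<beta>] ord_at_ev(2)[OF \<beta> False] by simp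
    qed
    then have roots: "{z. z ^ q + z = \<alpha> ^ (q + 1)} \<subseteq> {z. poly ?a z = 0}"
      unfolding ev2_def by (auto simp: ev1_def[of "ev1 to_ac \<alpha>"])
    have "?a = 0"
    proof (rule ccontr)
      assume nz: "?a \<noteq> 0"
      obtain \<beta> where "\<beta> ^ q + \<beta> = \<alpha> ^ (q + 1)" using exists_above by blast
      then have c: "card {z. z ^ q + z = \<alpha> ^ (q + 1)} = q"
        by (subst roots_above) (auto simp: card_image inj_on_def card_trace_kernel)
      have "card {z. z ^ q + z = \<alpha> ^ (q + 1)} \<le> card {z. poly ?a z = 0}"
        by (intro card_mono poly_roots_finite nz roots)
      also have "\<dots> \<le> degree ?a" by (rule card_poly_roots_bound[OF nz])
      also have "\<dots> \<le> degree A" by (rule degree_map_poly_le)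
      finally show False using A(1) c by linarith
    qed
    then have "ev1 to_ac \<alpha> (coeff A j) = 0" for j
      by (metis E.coeff_map_poly_hom coeff_0)
    then have "[:p:] dvd A" using pdvd by (simp add: const_poly_dvd_iff)
    then obtain A' where A': "A = [:p:] * A'" by (elim dvdE)
    obtain N' where N': "N = p * N'" using pdvd[OF \<alpha>] by (elim dvdE)
    have "N' \<noteq> 0" using N N' by auto
    have "ev1 emb x p * (ev1 emb x N' * g) = ev1 emb x p * ev A'"
    proof -
      interpret E1: comm_ring_hom "ev1 emb x" by (rule ev1_hom[OF comm_ring_hom_emb])
      have "ev1 emb x N * g = ev1 emb x p * (ev1 emb x N' * g)" by (simp add: N' E1.hom_mult)
      moreover have "ev A = ev1 emb x p * ev A'"
        unfolding A' ev.hom_mult by (simp add: ev2_const[OF comm_ring_hom_emb])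
      ultimately show ?thesis using A(2) by metis
    qed
    then have "ev1 emb x N' * g = ev A'" using ev1_nonzero[of p] p by simp
    moreover have "degree A' < q"
      using A(1) p unfolding A' by (cases "A' = 0") (simp_all add: degree_mult_eq)
    ultimately have "degree N \<le> degree N'" using min[of N'] \<open>N' \<noteq> 0\<close> by blast
    then show False using N' \<open>N' \<noteq> 0\<close> p \<open>degree p \<noteq> 0\<close> by (simp add: degree_mult_eq)
  qed
  then obtain c where c: "N = [:c:]" by (elim degree_eq_zeroE)
  then have "c \<noteq> 0" using N by auto
  have "ev (smult [:inverse c:] A) = emb (inverse c) * ev A"
  proof -
    have "smult [:inverse c:] A = [:[:inverse c:]:] * A" by simp
    then show ?thesis by (simp only: ev.hom_mult ev_const)
  qed
  also have "\<dots> = emb (inverse c * c) * g"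
    unfolding A(2)[symmetric] c by (simp add: ev1_const[OF comm_ring_hom_emb] hom_mult)
  also have "\<dots> = g" using \<open>c \<noteq> 0\<close> by simp
  finally have "g = ev (smult [:inverse c:] A)" by simp
  moreover have "degree (smult [:inverse c:] A) < q"
    using A(1) degree_smult_le le_less_trans by blast
  ultimately show thesis using that by blast
qed

end

section \<open>Rational points\<close>

lemma ev2_to_ac: "ev2 to_ac (to_ac a) (to_ac b) A = to_ac (ev2 (\<lambda>c. c) a b A)"
  using ev2_comp[OF comm_ring_hom_id comm_ring_hom_to_ac, of a b A] by simp

context hermitian_square
begin

abbreviation val :: "'k \<Rightarrow> 'k \<Rightarrow> 'k poly poly \<Rightarrow> 'k" where
  "val \<equiv> ev2 (\<lambda>c. c)"

sublocale val: comm_ring_hom "val a b" for a b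
  by (rule ev2_hom[OF comm_ring_hom_id])

lemma val_const [simp]: "val a b [:[:c:]:] = c"
  and val_x [simp]: "val a b [:[:0, 1:]:] = a"
  and val_y [simp]: "val a b [:0, 1:] = b"
  by (simp_all add: ev2_const ev2_pCons ev1_pCons ev1_1 comm_ring_hom_id)

lemma to_ac_curve: "b ^ q + b = a ^ (q + 1) \<Longrightarrow> to_ac b ^ q + to_ac b = to_ac a ^ (q + 1)" for a b :: 'k
  by (simp flip: to_ac_power to_ac_add to_ac_mult)

definition ord_rat :: "'k \<Rightarrow> 'k \<Rightarrow> 'f \<Rightarrow> int" where
  "ord_rat a b = ord_at (to_ac a) (to_ac b)"

lemma ord_rat_ev:
  assumes "b ^ q + b = a ^ (q + 1)" "ev A \<noteq> 0"
  shows "0 \<le> ord_rat a b (ev A)" "0 < ord_rat a b (ev A) \<longleftrightarrow> val a b A = 0"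
  using ord_at_ev[OF to_ac_curve[OF assms(1)] assms(2)] by (simp_all add: ord_rat_def ev2_to_ac)

lemma ord_rat_mult:
  assumes "b ^ q + b = a ^ (q + 1)" "f \<in> F" "g \<in> F" "f \<noteq> 0" "g \<noteq> 0"
  shows "ord_rat a b (f * g) = ord_rat a b f + ord_rat a b g"
  using ord_at_mult[OF to_ac_curve[OF assms(1)] assms(2-5)] by (simp add: ord_rat_def)

lemma ord_rat_x:
  assumes "b ^ q + b = a ^ (q + 1)"
  shows "ord_rat a b (x - emb a) = 1"
proof -
  interpret L: hermitian_laurent emb q x y "x_at (to_ac a)" "y_at (to_ac a) (to_ac b)"
    by (rule laurent_at[OF to_ac_curve[OF assms]])
  have "L.tr (x - emb a) = x_at (to_ac a) - fls_emb a"
    by (simp add: L.tr_diff)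
  also have "\<dots> = fls_X" by (simp add: x_at_def)
  finally show ?thesis by (simp add: ord_rat_def ord_at_def)
qed

lemma of_nat_q: "of_nat q = (0 :: 'k)"
proof -
  obtain n where n: "q = CHAR('k) ^ n" using CHAR_power[OF primepow_q card_UNIV] by blast
  then have "n \<noteq> 0" using q2 by (intro notI) simp
  then show ?thesis using n by (simp add: of_nat_eq_0_iff_char_dvd)
qed

text \<open>Smoothness at the point: y - b divides y^q + y - (b^q + b), and the cofactor takes the
  value 1 + q b^(q-1) = 1 there. So y - b is x - a times C/U, a function regular at the
  point.\<close>

lemma uniformizer:
  assumes "b ^ q + b = a ^ (q + 1)"
  obtains U C where "val a b U \<noteq> 0" "(y - emb b) * ev U = (x - emb a) * ev C"
proof -
  let ?x = "[:[:0, 1:]:] :: 'k poly poly" and ?y = "[:0, 1:] :: 'k poly poly"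
  let ?a = "[:[:a:]:]" and ?b = "[:[:b:]:]"
  define U where "U = 1 + (\<Sum>i<q. ?b ^ (q - Suc i) * ?y ^ i)"
  define C where "C = (\<Sum>i<q + 1. ?a ^ (q + 1 - Suc i) * ?x ^ i)"
  have U: "(?y - ?b) * U = ?y ^ q + ?y - (?b ^ q + ?b)"
    unfolding U_def distrib_left power_diff_sumr2[symmetric] by simp
  have C: "(?x - ?a) * C = ?x ^ (q + 1) - ?a ^ (q + 1)"
    unfolding C_def power_diff_sumr2[symmetric] ..
  have "val a b U = 1 + (\<Sum>i<q. b ^ (q - Suc i) * b ^ i)"
    unfolding U_def by (simp only: val.hom_add val.hom_one val.hom_sum val.hom_mult val.hom_power val_const val_y)
  also have "(\<Sum>i<q. b ^ (q - Suc i) * b ^ i) = (\<Sum>i<q. b ^ (q - 1))"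
    by (intro sum.cong) (auto simp flip: power_add)
  also have "\<dots> = 0" by (simp add: of_nat_q)
  finally have "val a b U = 1" by simp
  moreover have "(y - emb b) * ev U = y ^ q + y - emb (b ^ q + b)"
    using arg_cong[OF U, of ev]
    by (simp only: ev.hom_add ev.hom_minus ev.hom_mult ev.hom_power ev_y ev_const hom_add hom_power)
  moreover have "(x - emb a) * ev C = x ^ (q + 1) - emb (a ^ (q + 1))"
    using arg_cong[OF C, of ev]
    by (simp only: ev.hom_minus ev.hom_mult ev.hom_power ev_x ev_const hom_power)
  ultimately show thesis using that[of U C] curve_equation assms by simp
qed

lemma ev_decomposition:
  obtains A1 A2 where "ev A = emb (val a b A) + (x - emb a) * ev A1 + (y - emb b) * ev A2"
proof -
  obtain A1 A2 where
    A: "A = [:[:val a b A:]:] + [:[:-a, 1:]:] * [:A1:] + [:- [:b:], 1:] * A2"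
    by (rule ev2_ideal_decomposition)
  have "ev [:[:-a, 1:]:] = x - emb a" "ev [:- [:b:], 1:] = y - emb b"
    by (simp_all add: ev2_const ev2_pCons ev1_pCons ev1_1 comm_ring_hom_emb hom_uminus)
  then show thesis
    using that[of "[:A1:]" A2] arg_cong[OF A, of ev]
    by (simp only: ev.hom_add ev.hom_mult ev_const)
qed

lemma y_minus_const_nonzero: "y - emb b \<noteq> 0"
  using ev_nonzero[of "[:- [:b:], 1:]"] q2
  by (simp add: ev2_pCons ev1_pCons ev1_1 comm_ring_hom_emb hom_uminus)

lemma y_nonzero: "y \<noteq> 0"
  using y_minus_const_nonzero[of 0] by simp

text \<open>In the local ring of the point, x - a generates the maximal ideal: a polynomial
  vanishing there is a combination of x - a and y - b, and \<open>uniformizer\<close> trades the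
  latter for the former. Each such step lowers the order by one until a unit remains.\<close>

lemma local_factorization:
  assumes "b ^ q + b = a ^ (q + 1)" "ev A \<noteq> 0" "nat (ord_rat a b (ev A)) = n"
  shows "\<exists>B C. val a b B \<noteq> 0 \<and> val a b C \<noteq> 0 \<and> ev A * ev C = (x - emb a) ^ n * ev B"
  using assms(2,3)
proof (induction n arbitrary: A)
  case 0
  then have "val a b A \<noteq> 0" using ord_rat_ev[OF assms(1), of A] by simp
  then show ?case by (intro exI[of _ A] exI[of _ 1]) simp
next
  case (Suc n)
  then have "0 < ord_rat a b (ev A)" by linarith
  then have "val a b A = 0" using ord_rat_ev(2)[OF assms(1) Suc.prems(1)] by simp
  then obtain A1 A2 where A: "ev A = (x - emb a) * ev A1 + (y - emb b) * ev A2"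
    using ev_decomposition[of A a b] by auto
  obtain U C where U: "val a b U \<noteq> 0" "(y - emb b) * ev U = (x - emb a) * ev C"
    by (rule uniformizer[OF assms(1)])
  let ?A = "A1 * U + C * A2"
  have eq: "ev A * ev U = (x - emb a) * ev ?A"
  proof -
    have "ev A * ev U = (x - emb a) * ev A1 * ev U + ((y - emb b) * ev U) * ev A2"
      unfolding A by (simp add: algebra_simps)
    then show ?thesis unfolding U(2) by (simp add: ev.hom_add ev.hom_mult algebra_simps)
  qed
  have nz: "ev U \<noteq> 0"
  proof
    assume "ev U = 0"
    then have "hermitian_poly q dvd U" by (simp add: ev_eq_0_iff)
    then obtain V where V: "U = hermitian_poly q * V" by (elim dvdE)
    have "val a b (hermitian_poly q) = 0"
      using assms(1) by (simp add: ev2_hermitian_poly[OF comm_ring_hom_id])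
    then show False using U(1) V by (simp add: val.hom_mult)
  qed
  then have A': "ev ?A \<noteq> 0" using eq Suc.prems(1) by auto
  have "ord_rat a b (ev U) = 0"
    using ord_rat_ev[OF assms(1) nz] U(1) by simp
  then have "ord_rat a b (ev A) = 1 + ord_rat a b (ev ?A)"
    using ord_rat_mult[OF assms(1), of "ev A" "ev U"] ord_rat_mult[OF assms(1), of "x - emb a" "ev ?A"]
      eq nz A' Suc.prems(1) x_minus_const_nonzero ord_rat_x[OF assms(1)]
    by (simp add: F_diff)
  then have "nat (ord_rat a b (ev ?A)) = n"
    using Suc.prems(2) ord_rat_ev(1)[OF assms(1) A'] by simp
  from Suc.IH[OF A' this] obtain B D where
    BD: "val a b B \<noteq> 0" "val a b D \<noteq> 0" "ev ?A * ev D = (x - emb a) ^ n * ev B" by blast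
  have "ev A * ev (U * D) = (x - emb a) * (ev ?A * ev D)"
    using eq by (simp add: ev.hom_mult mult.assoc[symmetric])
  then have "ev A * ev (U * D) = (x - emb a) ^ Suc n * ev B"
    unfolding BD(3) by simp
  then show ?case using BD U(1) by (intro exI[of _ B] exI[of _ "U * D"]) (simp add: val.hom_mult)
qed

section \<open>Places centred at a rational point\<close>

lemma small_const_imp_0:
  assumes "P \<in> places emb F" "valuation.small F P (emb c)"
  shows "c = 0"
proof -
  interpret V: valuation F P by (rule valuation_place[OF assms(1)])
  show ?thesis using assms(2) by (auto simp: V.small_def place_emb[OF assms(1)])
qed

lemma place_integral_ev:
  assumes "P \<in> places emb F" "valuation.integral F P x" "valuation.integral F P y"
  shows "valuation.integral F P (ev A)"
proof -
  interpret V: valuation F P by (rule valuation_place[OF assms(1)])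
  have c: "V.integral (emb c)" for c by (simp add: V.integral_def place_emb[OF assms(1)])
  have 0: "V.integral 0" by (simp add: V.integral_def)
  have "V.integral (ev1 emb x p)" for p
    by (induction p) (auto simp: ev1_pCons comm_ring_hom_emb 0 c assms intro!: V.integral_add V.integral_mult)
  then show ?thesis
    by (induction A) (auto simp: ev2_pCons comm_ring_hom_emb 0 assms intro!: V.integral_add V.integral_mult)
qed

text \<open>The valuation ring of such a place contains the local ring of (a, b), and its residue
  map on polynomials is evaluation at (a, b).\<close>

lemma place_center:
  assumes "P \<in> places emb F" "0 < P (x - emb a)" "0 < P (y - emb b)"
  shows "valuation.small F P (ev A - emb (val a b A))" "val a b A \<noteq> 0 \<Longrightarrow> ev A \<noteq> 0 \<and> P (ev A) = 0"
    "valuation.integral F P (ev A)"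
proof -
  interpret V: valuation F P by (rule valuation_place[OF assms(1)])
  have c: "V.integral (emb c)" for c by (simp add: V.integral_def place_emb[OF assms(1)])
  have s: "V.small (x - emb a)" "V.small (y - emb b)"
    using assms by (simp_all add: V.small_def F_diff)
  have "V.integral (x - emb a + emb a)" "V.integral (y - emb b + emb b)"
    by (intro V.integral_add c V.small_imp_integral s)+
  then have xy: "V.integral x" "V.integral y" by simp_all
  note int = place_integral_ev[OF assms(1) xy]
  then show "V.integral (ev A)" .
  obtain A1 A2 where A: "ev A = emb (val a b A) + (x - emb a) * ev A1 + (y - emb b) * ev A2"
    by (rule ev_decomposition)
  show *: "V.small (ev A - emb (val a b A))"
    unfolding A using V.small_add[OF V.small_mult[OF s(1) int] V.small_mult[OF s(2) int]] by (simp add: add.assoc)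
  show "ev A \<noteq> 0 \<and> P (ev A) = 0" if "val a b A \<noteq> 0"
    using V.v_add_small[OF *, of "emb (val a b A)"] that by (simp add: place_emb[OF assms(1)])
qed

text \<open>By \<open>local_factorization\<close>, \<open>P\<close> equals
  \<open>ord_rat a b\<close> times the positive integer \<open>P (x - emb a)\<close>. Since
  \<open>P\<close> takes the value 1 somewhere, this factor divides 1.\<close>

lemma place_unique:
  assumes "b ^ q + b = a ^ (q + 1)"
    and P: "P \<in> places emb F" "0 < P (x - emb a)" "0 < P (y - emb b)" and "f \<in> F" "f \<noteq> 0"
  shows "P f = ord_rat a b f"
proof -
  interpret V: valuation F P by (rule valuation_place[OF P(1)])
  let ?t = "x - emb a"
  have t: "?t \<in> F" "?t \<noteq> 0" using x_minus_const_nonzero by (auto intro: F_intros)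
  have ev: "P (ev A) = ord_rat a b (ev A) * P ?t" if nz: "ev A \<noteq> 0" for A
  proof -
    obtain B C where BC: "val a b B \<noteq> 0" "val a b C \<noteq> 0"
      "ev A * ev C = ?t ^ nat (ord_rat a b (ev A)) * ev B"
      using local_factorization[OF assms(1) nz refl] by blast
    have "P (ev A * ev C) = P (ev A) + P (ev C)"
      using place_center(2)[OF P BC(2)] nz V.v_mult[of "ev A" "ev C"] by simp
    moreover have "P (?t ^ nat (ord_rat a b (ev A)) * ev B) = int (nat (ord_rat a b (ev A))) * P ?t + P (ev B)"
      using place_center(2)[OF P BC(1)] t by (simp add: V.v_mult V.v_power)
    ultimately show ?thesis
      using place_center(2)[OF P BC(1)] place_center(2)[OF P BC(2)] BC(3) ord_rat_ev(1)[OF assms(1) nz]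
      by simp
  qed
  have all: "P g = ord_rat a b g * P ?t" if g: "g \<in> F" "g \<noteq> 0" for g
  proof -
    obtain A B where AB: "ev B \<noteq> 0" "g = ev A / ev B" using F_quotientE[OF g(1)] .
    then have A: "ev A = g * ev B" by simp
    have "P (g * ev B) = P g + P (ev B)" "ord_rat a b (g * ev B) = ord_rat a b g + ord_rat a b (ev B)"
      using g AB(1) ord_rat_mult[OF assms(1), of g "ev B"] by (simp_all add: V.v_mult)
    moreover have "ev A \<noteq> 0" using A AB(1) g by simp
    ultimately show ?thesis using ev[of A] ev[OF AB(1)] unfolding A by (simp add: algebra_simps)
  qed
  obtain g where g: "g \<in> F" "g \<noteq> 0" "P g = 1" using place_surj[OF P(1)] by blast
  then have "ord_rat a b g * P ?t = 1" using all[OF g(1,2)] by simp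
  then have "P ?t = 1" using P(2) by (auto simp: zmult_eq_1_iff)
  then show ?thesis using all[OF assms(5,6)] by simp
qed

abbreviation pl :: "'k \<Rightarrow> 'k \<Rightarrow> 'f \<Rightarrow> int" where
  "pl a b \<equiv> affine_point_place emb x y a b"

text \<open>Existence comes from the branch at the point, uniqueness from
  \<open>place_unique\<close>. This is what makes the definite description in
  \<open>affine_point_place\<close> denote the intended place.\<close>

lemma affine_point_place_unique:
  assumes "b ^ q + b = a ^ (q + 1)"
  shows "\<exists>!P. P \<in> places emb F \<and> 0 < P (x - emb a) \<and> 0 < P (y - emb b)"
proof (rule ex_ex1I)
  let ?\<alpha> = "to_ac a" and ?\<beta> = "to_ac b"
  interpret L: hermitian_laurent emb q x y "x_at ?\<alpha>" "y_at ?\<alpha> ?\<beta>"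
    by (rule laurent_at[OF to_ac_curve[OF assms]])
  have x: "fls_subdegree (L.tr (x - emb a)) = 1"
    using ord_rat_x[OF assms] by (simp add: ord_rat_def ord_at_def)
  have "ev [:- [:b:], 1:] = y - emb b"
    by (simp add: ev2_pCons ev1_pCons ev1_1 comm_ring_hom_emb hom_uminus)
  moreover have "val a b [:- [:b:], 1:] = 0"
    by (simp add: ev2_pCons ev1_pCons ev1_1 comm_ring_hom_id)
  ultimately have y: "0 < fls_subdegree (L.tr (y - emb b))"
    using ord_rat_ev(2)[OF assms, of "[:- [:b:], 1:]"] y_minus_const_nonzero
    by (simp add: ord_rat_def ord_at_def)
  obtain P d where P: "P \<in> places emb F" "d > 0"
    "\<forall>f\<in>F. f \<noteq> 0 \<longrightarrow> fls_subdegree (L.tr f) = d * P f"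
    using L.place_exists[of "x - emb a"] x by (auto simp: F_diff)
  have "d * P (x - emb a) > 0" "d * P (y - emb b) > 0"
    using P(3)[rule_format, of "x - emb a"] P(3)[rule_format, of "y - emb b"] x y
      x_minus_const_nonzero[of a] y_minus_const_nonzero[of b] by (simp_all add: F_diff)
  then show "\<exists>P. P \<in> places emb F \<and> 0 < P (x - emb a) \<and> 0 < P (y - emb b)"
    using P(1,2) by (auto simp: zero_less_mult_iff)
next
  fix P P'
  assume P: "P \<in> places emb F \<and> 0 < P (x - emb a) \<and> 0 < P (y - emb b)"
    and P': "P' \<in> places emb F \<and> 0 < P' (x - emb a) \<and> 0 < P' (y - emb b)"
  have "P f = P' f" if "f \<in> F" "f \<noteq> 0" for f
    using place_unique[OF assms, of P f] place_unique[OF assms, of P' f] P P' that by simp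
  then show "P = P'" using P P' by (intro place_eqI) simp_all
qed

lemma
  assumes "b ^ q + b = a ^ (q + 1)"
  shows pl_place: "pl a b \<in> places emb F"
    and pl_x: "0 < pl a b (x - emb a)" and pl_y: "0 < pl a b (y - emb b)"
  using theI'[OF affine_point_place_unique[OF assms]] by (auto simp: affine_point_place_def)

lemma pl_eqI:
  assumes "b ^ q + b = a ^ (q + 1)" "P \<in> places emb F" "0 < P (x - emb a)" "0 < P (y - emb b)"
  shows "P = pl a b"
  using affine_point_place_unique[OF assms(1)] pl_place[OF assms(1)] pl_x[OF assms(1)] pl_y[OF assms(1)] assms
  by blast

lemma pl_uniformizer: "b ^ q + b = a ^ (q + 1) \<Longrightarrow> pl a b (x - emb a) = 1"
  using place_unique[OF _ pl_place pl_x pl_y, of b a "x - emb a"] ord_rat_x[of b a] x_minus_const_nonzero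
  by (simp add: F_diff)

text \<open>Two residues of one function differ by a constant in the maximal ideal. Distinct points
  therefore carry distinct places.\<close>

lemma center_unique:
  assumes "P \<in> places emb F" "g \<in> F" "0 < P (g - emb c)" "0 < P (g - emb d)"
  shows "c = d"
proof -
  interpret V: valuation F P by (rule valuation_place[OF assms(1)])
  have "V.small (g - emb c)" "V.small (g - emb d)"
    using assms by (auto simp: V.small_def F_diff)
  from V.small_diff[OF this(2,1)] have "V.small (emb (c - d))" by (simp add: hom_minus)
  then show ?thesis using small_const_imp_0[OF assms(1)] by force
qed

end

section \<open>The Riemann--Roch space\<close>

text \<open>Both sides are monic of degree q, so their difference has degree less than q while it
  vanishes on the q elements of \<open>B\<close>.\<close>

lemma trace_poly_split:
  assumes "2 \<le> q" "finite B" "card B = q" "\<And>b. b \<in> B \<Longrightarrow> b ^ q + b = (0 :: 'k::field)"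
  shows "(\<Prod>b\<in>B. [:- b, 1:]) = monom 1 q + monom 1 1"
proof (rule ccontr)
  let ?p = "\<Prod>b\<in>B. [:- b, 1:]" and ?r = "monom 1 q + monom 1 1 :: 'k poly"
  assume "?p \<noteq> ?r"
  then have nz: "?p - ?r \<noteq> 0" by simp
  have p: "degree ?p = q" using assms(3) by (simp add: degree_prod_eq_sum_degree)
  have lp: "lead_coeff ?p = 1" unfolding lead_coeff_prod by simp
  have r: "degree ?r = q"
    using assms(1) by (subst degree_add_eq_left) (auto simp: degree_monom_eq)
  have "coeff ?r q = 1" using assms(1) by simp
  then have "coeff (?p - ?r) q = 0" using lp p by simp
  moreover have "degree (?p - ?r) \<le> q" by (rule degree_diff_le) (use p r in auto)
  ultimately have "degree (?p - ?r) < q" using nz by (metis le_neq_implies_less leading_coeff_0_iff)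
  moreover have "B \<subseteq> {z. poly (?p - ?r) z = 0}"
    using assms(2,4) by (auto simp: poly_prod poly_monom prod_zero_iff)
  then have "card B \<le> card {z. poly (?p - ?r) z = 0}"
    by (intro card_mono poly_roots_finite nz)
  ultimately show False
    using card_poly_roots_bound[OF nz] assms(3) by linarith
qed

lemma (in valuation) small_mult_unitD:
  assumes "small (a * b)" "a \<in> S" "b \<in> S" "b \<noteq> 0" "v b = 0"
  shows "small a"
  using assms v_mult[of a b] by (cases "a = 0") (auto simp: small_def)

context hermitian_square
begin

lemma finite_trace_kernel: "finite trace_kernel"
  by simp

lemma trace_kernel_curve: "b \<in> trace_kernel \<Longrightarrow> b ^ q + b = 0 ^ (q + 1)"
  by (simp add: trace_kernel_def)

lemma zero_in_trace_kernel: "0 \<in> trace_kernel"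
  using q2 by (simp add: trace_kernel_def)

lemma y_split: "y ^ q + y = (\<Prod>b\<in>trace_kernel. y - emb b)"
proof -
  interpret E: comm_ring_hom "ev1 emb y" by (rule ev1_hom[OF comm_ring_hom_emb])
  have "ev1 emb y (monom 1 q + monom 1 1) = ev1 emb y (\<Prod>b\<in>trace_kernel. [:- b, 1:])"
    by (subst trace_poly_split[OF q2 finite_trace_kernel card_trace_kernel]) (auto simp: trace_kernel_def)
  then show ?thesis
    by (simp add: E.hom_add E.hom_prod ev1_monom ev1_pCons ev1_1 comm_ring_hom_emb hom_uminus)
qed

section \<open>Values of x and y at an arbitrary place\<close>

lemma place_x_power: "P \<in> places emb F \<Longrightarrow> P (x ^ (q + 1)) = int (q + 1) * P x"
  by (rule valuation.v_power[OF valuation_place F_x x_nonzero])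

text \<open>At a pole of y the term y^q dominates in y^q + y = x^(q+1); at a zero of y, treated
  below, the term y does. This fixes the ratio of the values of y and x without any description of
  the place.\<close>

lemma place_y_pole:
  assumes P: "P \<in> places emb F" and "P y < 0"
  shows "int q * P y = int (q + 1) * P x"
proof -
  interpret V: valuation F P by (rule valuation_place[OF P])
  have "P (y ^ q) < P y"
    using assms(2) q2 y_nonzero by (simp add: V.v_power)
  then have "P (y ^ q + y) = P (y ^ q)"
    using y_nonzero by (intro V.v_add_strict) (auto intro: F_intros)
  then show ?thesis
    unfolding curve_equation place_x_power[OF P] V.v_power[OF F_y y_nonzero] ..
qed

lemma place_y_nonneg:
  assumes P: "P \<in> places emb F" and "0 \<le> P x"
  shows "0 \<le> P y"
  using place_y_pole[OF P] assms(2) q2 by (smt (verit) mult_pos_neg of_nat_0_less_iff zero_less_Suc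
    Suc_eq_plus1 mult_nonneg_nonneg of_nat_0_le_iff less_le_trans zero_less_numeral)

lemma place_y_neg:
  assumes P: "P \<in> places emb F" and "P x < 0"
  shows "P y < 0"
proof (rule ccontr)
  interpret V: valuation F P by (rule valuation_place[OF P])
  assume "\<not> P y < 0"
  then have "V.integral y" "V.integral (y ^ q)"
    using y_nonzero by (auto simp: V.integral_def V.v_power F_power)
  then have "V.integral (x ^ (q + 1))"
    using V.integral_add curve_equation by metis
  then have "x ^ (q + 1) = 0 \<or> 0 \<le> P (x ^ (q + 1))"
    unfolding V.integral_def by blast
  then have "0 \<le> int (q + 1) * P x"
    unfolding place_x_power[OF P] using x_nonzero by simp
  then show False using assms(2) by (simp add: zero_le_mult_iff)
qed

lemma place_y_zero:
  assumes P: "P \<in> places emb F" and "0 < P y"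
  shows "P y = int (q + 1) * P x"
proof -
  interpret V: valuation F P by (rule valuation_place[OF P])
  have "P y < P (y ^ q)"
    using assms(2) q2 y_nonzero by (simp add: V.v_power)
  then have "P (y + y ^ q) = P y"
    using y_nonzero by (intro V.v_add_strict) (auto intro: F_intros)
  then show ?thesis
    unfolding add.commute[of y] curve_equation place_x_power[OF P] ..
qed

text \<open>The product of y - b over the trace kernel equals x^(q+1), so one factor vanishes
  wherever x does. All zeros of x are therefore rational points.\<close>

lemma place_above_0:
  assumes P: "P \<in> places emb F" and "0 < P x"
  obtains b where "b \<in> trace_kernel" "P = pl 0 b"
proof -
  interpret V: valuation F P by (rule valuation_place[OF P])
  have c: "V.integral (emb c)" for c by (simp add: V.integral_def place_emb[OF P])
  have "V.integral y" using place_y_nonneg[OF P] assms(2) by (simp add: V.integral_def)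
  then have int: "0 \<le> P (y - emb b)" for b
    using V.integral_add[of y "emb (- b)"] c[of "- b"] y_minus_const_nonzero[of b]
    by (simp add: V.integral_def hom_uminus)
  have "\<exists>b\<in>trace_kernel. 0 < P (y - emb b)"
  proof (rule ccontr)
    assume "\<not> ?thesis"
    then have 0: "P (y - emb b) = 0" if "b \<in> trace_kernel" for b
      using int[of b] that by force
    have "(\<Prod>b\<in>B. y - emb b) \<in> F \<and> P (\<Prod>b\<in>B. y - emb b) = 0" if "B \<subseteq> trace_kernel" for B
      using finite_subset[OF that finite_trace_kernel] that
    proof (induction B)
      case (insert b B)
      then show ?case
        using 0[of b] y_minus_const_nonzero V.v_mult[of "y - emb b" "\<Prod>b\<in>B. y - emb b"]
        by (simp add: F_mult F_diff)
    qed simp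
    then have "P (x ^ (q + 1)) = 0"
      using y_split curve_equation by simp
    then show False using assms(2) unfolding place_x_power[OF P] by simp
  qed
  then obtain b where b: "b \<in> trace_kernel" "0 < P (y - emb b)" by blast
  then have "P = pl 0 b"
    using assms by (intro pl_eqI trace_kernel_curve) simp_all
  then show thesis using that b by blast
qed

lemma pl_0_x: "b \<in> trace_kernel \<Longrightarrow> pl 0 b x = 1"
  using pl_uniformizer[OF trace_kernel_curve, of b] by simp

lemma pl_0_inj:
  assumes "b \<in> trace_kernel" "c \<in> trace_kernel" "pl 0 b = pl 0 c"
  shows "b = c"
  using center_unique[OF pl_place[OF trace_kernel_curve[OF assms(1)]] F_y, of b c]
    pl_y[OF trace_kernel_curve[OF assms(1)]] pl_y[OF trace_kernel_curve[OF assms(2)]] assms(3) by simp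

section \<open>The divisor and the functions it admits\<close>

abbreviation "G \<equiv> hermitian_divisor emb q x y 2"

lemma divisor_eq: "G P = 2 * (\<Sum>b\<in>trace_kernel - {0}. if P = pl 0 b then 1 else 0)"
proof -
  have "{b. b \<noteq> 0 \<and> b ^ q + b = 0} = trace_kernel - {0}" by (auto simp: trace_kernel_def)
  then show ?thesis by (simp add: hermitian_divisor_def place_divisor_def)
qed

text \<open>Distinct b give distinct places; coinciding ones would accumulate a larger
  coefficient.\<close>

lemma divisor_at:
  assumes "b \<in> trace_kernel" "b \<noteq> 0"
  shows "G (pl 0 b) = 2"
proof -
  have "(\<Sum>c\<in>trace_kernel - {0}. if pl 0 b = pl 0 c then 1 else 0) =
    (\<Sum>c\<in>trace_kernel - {0}. if b = c then 1 else 0 :: int)"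
    by (intro sum.cong if_cong) (use pl_0_inj assms in auto)
  then show ?thesis using assms by (simp add: divisor_eq)
qed

lemma divisor_outside:
  assumes "\<And>b. b \<in> trace_kernel \<Longrightarrow> b \<noteq> 0 \<Longrightarrow> P \<noteq> pl 0 b"
  shows "G P = 0"
  unfolding divisor_eq using assms by (simp add: sum.neutral)

lemma divisor_x_nonpos: "P x \<le> 0 \<Longrightarrow> G P = 0"
  by (rule divisor_outside) (use pl_0_x in force)

lemma divisor_nonneg: "0 \<le> G P"
  unfolding divisor_eq by (intro mult_nonneg_nonneg sum_nonneg) auto

lemma quotient_bound:
  assumes P: "P \<in> places emb F"
  shows "0 \<le> P (y / x\<^sup>2) + G P"
proof -
  interpret V: valuation F P by (rule valuation_place[OF P])
  have "P (y / x\<^sup>2 * x\<^sup>2) = P (y / x\<^sup>2) + P (x\<^sup>2)"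
    using x_nonzero y_nonzero by (intro V.v_mult) (auto intro: F_intros)
  then have h: "P (y / x\<^sup>2) = P y - 2 * P x"
    using x_nonzero by (simp add: V.v_power)
  consider "P x < 0" | "P x = 0" | "0 < P x" by linarith
  then show ?thesis
  proof cases
    case 1
    have "int q * P y = int (q + 1) * P x"
      using place_y_pole[OF P place_y_neg[OF P 1]] .
    \<comment> \<open>At a pole of x the value of y is (q + 1)/q times that of x, and q + 1 - 2 q =
      1 - q.\<close>
    then have "int q * P (y / x\<^sup>2) = (1 - int q) * P x"
      unfolding h by (simp add: algebra_simps)
    also have "\<dots> \<ge> 0" using 1 q2 by (intro mult_nonpos_nonpos) auto
    finally have "0 \<le> P (y / x\<^sup>2)" using q2 by (simp add: zero_le_mult_iff)
    then show ?thesis using divisor_nonneg[of P] by simp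
  next
    case 2
    then show ?thesis using h place_y_nonneg[OF P] divisor_nonneg[of P] by simp
  next
    case 3
    then obtain b where b: "b \<in> trace_kernel" "P = pl 0 b" by (rule place_above_0[OF P])
    \<comment> \<open>At the origin y has order q + 1 and x has order 1, so the quotient has order q
      - 1. At the remaining zeros of x its pole has order at most 2, which \<open>G\<close>
      permits.\<close>
    show ?thesis
    proof (cases "b = 0")
      case True
      then have "0 < P y" using b pl_y[OF trace_kernel_curve[OF b(1)]] by simp
      from place_y_zero[OF P this] show ?thesis
        using h b pl_0_x[OF b(1)] q2 divisor_nonneg[of P] by simp
    next
      case False
      then show ?thesis
        using h b pl_0_x[OF b(1)] divisor_at[OF b(1)] place_y_nonneg[OF P] 3 by simp
    qed
  qed
qed

lemma span_in_riemann_roch: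
  "emb c0 + emb c1 * (y / x\<^sup>2) \<in> riemann_roch_space emb F G"
proof -
  let ?h = "y / x\<^sup>2" and ?f = "emb c0 + emb c1 * (y / x\<^sup>2)"
  have h: "?h \<in> F" "?h \<noteq> 0" using x_nonzero y_nonzero by (simp_all add: F_divide F_power)
  have "0 \<le> P ?f + G P" if P: "P \<in> places emb F" and nz: "?f \<noteq> 0" for P
  proof -
    interpret V: valuation F P by (rule valuation_place[OF P])
    \<comment> \<open>The valuation inequality is available for nonzero summands only.\<close>
    consider "c1 = 0" | "c1 \<noteq> 0" "c0 = 0" | "c1 \<noteq> 0" "c0 \<noteq> 0" by blast
    then show ?thesis
    proof cases
      case 1
      then show ?thesis using divisor_nonneg[of P] by (simp add: place_emb[OF P])
    next
      case 2
      then show ?thesis using quotient_bound[OF P] h V.v_mult[of "emb c1" ?h] place_emb[OF P, of c1] by simp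
    next
      case 3
      then have "min (P (emb c0)) (P (emb c1 * ?h)) \<le> P ?f"
        using nz h by (intro V.v_add) (auto intro: F_intros)
      moreover have "P (emb c1 * ?h) = P ?h"
        using 3 h V.v_mult[of "emb c1" ?h] place_emb[OF P, of c1] by simp
      ultimately show ?thesis
        using quotient_bound[OF P] divisor_nonneg[of P] place_emb[OF P, of c0] by simp
    qed
  qed
  moreover have "?f \<in> F" using h by (intro F_add F_mult F_const)
  ultimately show ?thesis
    unfolding riemann_roch_space_def principal_divisor_def by blast
qed

text \<open>A nonzero polynomial in x that annihilates \<alpha> has positive order at the point, so
  the order is not identically 0 on \<open>F\<close>. The series x - \<alpha> itself need not come
  from \<open>F\<close>.\<close>

lemma ord_at_place:
  assumes "\<beta> ^ q + \<beta> = \<alpha> ^ (q + 1)"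
  shows "\<exists>P\<in>places emb F. \<exists>d>0. \<forall>f\<in>F. f \<noteq> 0 \<longrightarrow> ord_at \<alpha> \<beta> f = d * P f"
proof -
  interpret L: hermitian_laurent emb q x y "x_at \<alpha>" "y_at \<alpha> \<beta>" by (rule laurent_at[OF assms])
  obtain p :: "'k poly" where p: "p \<noteq> 0" "poly (map_poly to_ac p) \<alpha> = 0"
    by (rule alg_closure_algebraic)
  then have "0 < ord_at \<alpha> \<beta> (ev [:p:])"
    using ev1_nonzero[of p] by (subst ord_at_ev(2)[OF assms])
      (simp_all add: ev2_const comm_ring_hom_emb comm_ring_hom_to_ac ev1_def)
  then show ?thesis using L.place_exists[of "ev [:p:]"] by (simp add: ord_at_def)
qed

text \<open>The order is a positive multiple of a place, so its sign can be read off there. At a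
  zero of x the factor x^2 contributes 2, which makes up for the coefficient of \<open>G\<close>; at
  the other finite places \<open>G\<close> is 0.\<close>

lemma regular_of_riemann_roch:
  assumes f: "f \<in> riemann_roch_space emb F G" "f \<noteq> 0" and curve: "\<beta> ^ q + \<beta> = \<alpha> ^ (q + 1)"
  shows "0 \<le> ord_at \<alpha> \<beta> (f * x\<^sup>2)"
proof -
  have fF: "f \<in> F" and fG: "\<And>P. P \<in> places emb F \<Longrightarrow> 0 \<le> P f + G P"
    using f by (auto simp: riemann_roch_space_def principal_divisor_def)
  obtain P d where P: "P \<in> places emb F" and d: "d > 0"
    and ord: "\<And>f. f \<in> F \<Longrightarrow> f \<noteq> 0 \<Longrightarrow> ord_at \<alpha> \<beta> f = d * P f"
    using ord_at_place[OF curve] by blast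
  interpret V: valuation F P by (rule valuation_place[OF P])
  have g: "P (f * x\<^sup>2) = P f + 2 * P x"
    using fF f(2) x_nonzero by (simp add: V.v_mult V.v_power F_power)
  have "0 \<le> d * P x" using ord[of x] ord_at_ev(1)[OF curve, of "[:[:0, 1:]:]"] x_nonzero by simp
  then have "0 \<le> P x" using d by (simp add: zero_le_mult_iff)
  have "0 \<le> P f + 2 * P x"
  proof (cases "0 < P x")
    case True
    then obtain b where "b \<in> trace_kernel" "P = pl 0 b" by (rule place_above_0[OF P])
    moreover have "G P \<le> 2"
      using divisor_outside[of P] divisor_at by (metis order_refl zero_le_numeral)
    ultimately show ?thesis using fG[OF P] pl_0_x by simp
  next
    case False
    then show ?thesis using fG[OF P] divisor_x_nonpos[of P] \<open>0 \<le> P x\<close> by simp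
  qed
  then show ?thesis using ord[of "f * x\<^sup>2"] g d fF f(2) x_nonzero by (simp add: F_mult F_power)
qed

lemma riemann_roch_imp_polynomial:
  assumes f: "f \<in> riemann_roch_space emb F G" "f \<noteq> 0"
  obtains c0 c1 c2 c3 where "f * x\<^sup>2 = emb c0 + emb c1 * x + emb c2 * x\<^sup>2 + emb c3 * y"
proof -
  have fF: "f \<in> F" and fG: "\<And>P. P \<in> places emb F \<Longrightarrow> 0 \<le> P f + G P"
    using f by (auto simp: riemann_roch_space_def principal_divisor_def)
  have "f * x\<^sup>2 \<in> F" "f * x\<^sup>2 \<noteq> 0" using f(2) x_nonzero by (auto intro!: F_mult F_power fF)
  from regular_imp_polynomial[OF this regular_of_riemann_roch[OF f]]
  obtain A where A: "degree A < q" "f * x\<^sup>2 = ev A" by blast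
  then have "A \<noteq> 0" using \<open>f * x\<^sup>2 \<noteq> 0\<close> by auto
  interpret L: hermitian_laurent emb q x y x_inf y_inf by (rule laurent_inf)
  interpret fls: valuation UNIV "fls_subdegree :: 'k alg_closure fls \<Rightarrow> int"
    by (rule valuation_fls)
  obtain P d where P: "P \<in> places emb F" and d: "d > 0"
    and ord: "\<And>f. f \<in> F \<Longrightarrow> f \<noteq> 0 \<Longrightarrow> fls_subdegree (L.tr f) = d * P f"
    using L.place_exists[of x] subdegree_x_inf q2 by auto
  have "d * P x < 0" using ord[of x] subdegree_x_inf q2 x_nonzero by simp
  then have "P x \<le> 0" using d by (simp add: mult_less_0_iff)
  \<comment> \<open>A place where x has a pole is outside the support of \<open>G\<close>, so f is
    regular at infinity and only x^2 contributes to the pole order, namely 2 q.\<close>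
  then have "0 \<le> fls_subdegree (L.tr f)"
    using ord[OF fF f(2)] fG[OF P] divisor_x_nonpos[of P] d by simp
  moreover have "L.tr (f * x\<^sup>2) = L.tr f * x_inf\<^sup>2"
    using fF by (simp add: L.tr_mult L.tr_power F_power)
  moreover have nz: "x_inf \<noteq> 0" "y_inf \<noteq> 0"
    using subdegree_x_inf subdegree_y_inf q2 by auto
  ultimately have "- 2 * int q \<le> fls_subdegree (L.other.ev A)"
    using L.tr_eq_0_iff[OF fF] f(2) subdegree_x_inf by (simp add: A(2) L.tr_ev fls.v_power)
  moreover have "\<forall>j. coeff A j \<noteq> 0 \<longrightarrow>
    fls_subdegree (L.other.ev A) \<le> - int (q * degree (coeff A j) + (q + 1) * j)"
    using fls.v_ev2[OF L.other.comm_ring_hom_emb, of x_inf y_inf q A] nz q2 subdegree_x_inf subdegree_y_inf A(1) \<open>A \<noteq> 0\<close>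
    by simp
  ultimately have "int (q * degree (coeff A j) + (q + 1) * j) \<le> 2 * int q" if "coeff A j \<noteq> 0" for j
    using that by force
  then have w: "q * degree (coeff A j) + (q + 1) * j \<le> 2 * q" if "coeff A j \<noteq> 0" for j
    using that by (metis (mono_tags, lifting) of_nat_le_iff of_nat_mult of_nat_numeral)
  \<comment> \<open>Already y^2 has weight 2 q + 2.\<close>
  have c2: "coeff A j = 0" if "2 \<le> j" for j
  proof (rule ccontr)
    assume "coeff A j \<noteq> 0"
    from w[OF this] have "(q + 1) * j \<le> 2 * q" by simp
    moreover have "(q + 1) * 2 \<le> (q + 1) * j" using that by (rule mult_le_mono2)
    ultimately show False by simp
  qed
  \<comment> \<open>The monomial x y has weight 2 q + 1, one too many.\<close>
  have d1: "degree (coeff A 1) = 0"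
  proof (cases "coeff A 1 = 0")
    case False
    show ?thesis
    proof (rule ccontr)
      assume "degree (coeff A 1) \<noteq> 0"
      define k where "k = q * degree (coeff A 1)"
      have "q * 1 \<le> k" unfolding k_def using \<open>degree (coeff A 1) \<noteq> 0\<close> by (intro mult_le_mono2) simp
      moreover have "k + (q + 1) * 1 \<le> 2 * q" using w[OF False] unfolding k_def .
      ultimately show False by simp
    qed
  qed simp
  have "q * degree (coeff A 0) \<le> q * 2" if "coeff A 0 \<noteq> 0" using w[OF that] by simp
  then have d0: "degree (coeff A 0) \<le> 2" using q2 by (cases "coeff A 0 = 0") simp_all
  have "A = [:coeff A 0, coeff A 1:]"
    using c2 by (intro poly_eqI) (simp add: coeff_pCons split: nat.splits)
  moreover obtain c3 where "coeff A 1 = [:c3:]" using d1 by (elim degree_eq_zeroE)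
  moreover have "coeff A 0 = [:coeff (coeff A 0) 0, coeff (coeff A 0) 1, coeff (coeff A 0) 2:]"
    using d0 by (intro poly_eqI) (auto simp: coeff_pCons numeral_2_eq_2 coeff_eq_0 split: nat.splits)
  ultimately obtain c0 c1 c2 c3 where "A = [:[:c0, c1, c2:], [:c3:]:]" by metis
  then have "ev A = emb c0 + emb c1 * x + emb c2 * x\<^sup>2 + emb c3 * y"
    by (simp add: ev2_pCons ev1_pCons comm_ring_hom_emb algebra_simps power2_eq_square)
  then have "f * x\<^sup>2 = emb c0 + emb c1 * x + emb c2 * x\<^sup>2 + emb c3 * y"
    by (simp only: A(2))
  then show thesis by (rule that)
qed

text \<open>The double zero at the origin is used through two reductions modulo the maximal ideal
  there: the first forces the constant coefficient to be 0, and after division by x the second does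
  the same for that of x. The y-term survives both because y / x still vanishes at the origin, y
  having order q + 1.\<close>

lemma riemann_roch_imp_span:
  assumes f: "f \<in> riemann_roch_space emb F G" "f \<noteq> 0"
  shows "\<exists>c0 c1. f = emb c0 + emb c1 * (y / x\<^sup>2)"
proof -
  obtain c0 c1 c2 c3 where g: "f * x\<^sup>2 = emb c0 + emb c1 * x + emb c2 * x\<^sup>2 + emb c3 * y"
    by (rule riemann_roch_imp_polynomial[OF f])
  let ?P = "pl 0 0"
  have P: "?P \<in> places emb F"
    by (rule pl_place[OF trace_kernel_curve[OF zero_in_trace_kernel]])
  interpret V: valuation F ?P by (rule valuation_place[OF P])
  have c: "V.integral (emb c)" for c by (simp add: V.integral_def place_emb[OF P])
  have Px: "?P x = 1" by (rule pl_0_x[OF zero_in_trace_kernel])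
  have Py: "?P y = int (q + 1)"
    using place_y_zero[OF P] pl_y[OF trace_kernel_curve[OF zero_in_trace_kernel]] Px by simp
  have sx: "V.small x" and sy: "V.small y" using Px Py by (simp_all add: V.small_def)
  have "?P (y / x * x) = ?P (y / x) + ?P x"
    using x_nonzero y_nonzero by (intro V.v_mult) (auto intro: F_intros)
  then have syx: "V.small (y / x)"
    using x_nonzero Px Py q2 by (simp add: V.small_def F_divide)
  \<comment> \<open>The origin is the one zero of x that \<open>G\<close> omits, so f is regular
    there.\<close>
  have "G ?P = 0" using pl_0_inj zero_in_trace_kernel by (intro divisor_outside) blast
  then have "0 \<le> ?P f" "f \<in> F"
    using f P by (auto simp: riemann_roch_space_def principal_divisor_def)
  then have if': "V.integral f" by (simp add: V.integral_def)
  have "emb c0 = x * (f * x) - (x * (emb c1 + emb c2 * x) + y * emb c3)"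
    using g by (simp add: algebra_simps power2_eq_square)
  moreover have "V.small (x * (f * x) - (x * (emb c1 + emb c2 * x) + y * emb c3))"
    by (intro V.small_diff V.small_add V.small_mult sx sy c if' V.integral_mult V.integral_add V.small_imp_integral)
  ultimately have c0: "c0 = 0" using small_const_imp_0[OF P] by simp
  have "x * emb c1 = x * (x * f - (x * emb c2 + y / x * emb c3))"
    using g c0 x_nonzero by (simp add: algebra_simps power2_eq_square)
  then have "emb c1 = x * f - (x * emb c2 + y / x * emb c3)"
    using x_nonzero by simp
  moreover have "V.small (x * f - (x * emb c2 + y / x * emb c3))"
    by (intro V.small_diff V.small_add V.small_mult sx syx c if')
  ultimately have "c1 = 0" using small_const_imp_0[OF P] by simp
  then have "f = emb c2 + emb c3 * (y / x\<^sup>2)"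
    using g c0 x_nonzero by (simp add: field_simps)
  then show ?thesis by blast
qed

lemma riemann_roch_eq:
  "riemann_roch_space emb F G = (\<lambda>(c0, c1). emb c0 + emb c1 * (y / x\<^sup>2)) ` UNIV"
proof -
  have "f \<in> range (\<lambda>(c0, c1). emb c0 + emb c1 * (y / x\<^sup>2))" if "f \<in> riemann_roch_space emb F G" for f
  proof (cases "f = 0")
    case True
    then show ?thesis by (intro image_eqI[of _ _ "(0, 0)"]) simp_all
  next
    case False
    then show ?thesis using riemann_roch_imp_span[OF that] by auto
  qed
  then show ?thesis using span_in_riemann_roch by auto
qed

text \<open>For the claimed value c, the numerator (c0 - c) x^2 + c1 y of f - c vanishes at (a, b),
  and x^2 is a unit there as a is nonzero. Any other candidate would differ from c by a constant in
  the maximal ideal.\<close>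

lemma eval_at_span:
  assumes "b ^ q + b = a ^ (q + 1)" "a \<noteq> 0"
  shows "eval_at emb (pl a b) (emb c0 + emb c1 * (y / x\<^sup>2)) = c0 + c1 * (b / a\<^sup>2)"
proof -
  let ?P = "pl a b" and ?f = "emb c0 + emb c1 * (y / x\<^sup>2)" and ?c = "c0 + c1 * (b / a\<^sup>2)"
  note P = pl_place[OF assms(1)] and Pxy = pl_x[OF assms(1)] pl_y[OF assms(1)]
  interpret V: valuation F ?P by (rule valuation_place[OF P])
  have fF: "?f \<in> F" by (auto intro!: F_intros)
  let ?B = "[:[:0, 1:]:] ^ 2 :: 'k poly poly"
  let ?A = "[:[:c0 - ?c:]:] * ?B + [:[:c1:]:] * [:0, 1:]"
  have B: "ev ?B = x\<^sup>2" by (simp only: ev.hom_power ev_x)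
  have A: "ev ?A = (?f - emb ?c) * x\<^sup>2"
    using x_nonzero unfolding ev.hom_add ev.hom_mult B ev_const ev_y
    by (simp add: hom_minus hom_uminus hom_add field_simps)
  have "val a b ?A = 0"
    unfolding val.hom_add val.hom_mult val.hom_power val_const val_x val_y using assms(2) by simp
  then have "V.small (ev ?A)" using place_center(1)[OF P Pxy, of ?A] by simp
  moreover have "?P (x\<^sup>2) = 0"
    using place_center(2)[OF P Pxy, of ?B] assms(2) unfolding B val.hom_power val_x by simp
  ultimately have small: "V.small (?f - emb ?c)"
    unfolding A using fF x_nonzero
    by (elim V.small_mult_unitD) (simp_all only: F_diff F_const F_power F_x power_eq_0_iff, simp)
  have "c = ?c" if "V.small (?f - emb c)" for c
  proof -
    have "V.small (emb (?c - c))"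
      using V.small_diff[OF that small] by (simp add: hom_minus)
    then have "?c - c = 0" by (rule small_const_imp_0[OF P])
    then show ?thesis by simp
  qed
  moreover have small_iff: "(?f - emb c = 0 \<or> 0 < ?P (?f - emb c)) = V.small (?f - emb c)" for c
    unfolding V.small_def using F_diff[OF fF F_const] by blast
  ultimately show ?thesis
    unfolding eval_at_def small_iff using small by (intro the_equality)
qed

end

section \<open>The code\<close>

lemma two_generator_code:
  fixes g0 g1 :: "'k::field vec"
  assumes g: "g0 \<in> carrier_vec n" "g1 \<in> carrier_vec n"
    and indep: "\<And>a b. a \<cdot>\<^sub>v g0 + b \<cdot>\<^sub>v g1 = 0\<^sub>v n \<Longrightarrow> a = 0 \<and> b = 0"
    and C: "C = {a \<cdot>\<^sub>v g0 + b \<cdot>\<^sub>v g1 | a b. True}"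
  shows "linear_code n C" "code_dim n C = 2"
proof -
  interpret vec_space "TYPE('k)" n .
  let ?S = "{g0, g1}"
  \<comment> \<open>Equal generators would collapse the spanning set to a singleton, and the
    cardinality 2 would be lost.\<close>
  have ne: "g0 \<noteq> g1"
  proof
    assume "g0 = g1"
    then have "1 \<cdot>\<^sub>v g0 + (- 1) \<cdot>\<^sub>v g1 = 0\<^sub>v n" using g by (intro eq_vecI) auto
    then show False using indep by fastforce
  qed
  have S: "finite ?S" "?S \<subseteq> carrier_vec n" using g by auto
  have lc: "lincomb a ?S = a g0 \<cdot>\<^sub>v g0 + a g1 \<cdot>\<^sub>v g1" for a
  proof (rule eq_vecI)
    show "dim_vec (lincomb a ?S) = dim_vec (a g0 \<cdot>\<^sub>v g0 + a g1 \<cdot>\<^sub>v g1)"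
      using lincomb_dim[OF S] g by simp
    fix i assume "i < dim_vec (a g0 \<cdot>\<^sub>v g0 + a g1 \<cdot>\<^sub>v g1)"
    then have "i < n" using g by simp
    then show "lincomb a ?S $ i = (a g0 \<cdot>\<^sub>v g0 + a g1 \<cdot>\<^sub>v g1) $ i"
      using lincomb_index[OF _ S(2)] g ne by simp
  qed
  have "span ?S = C"
  proof -
    have "a \<cdot>\<^sub>v g0 + b \<cdot>\<^sub>v g1 = lincomb (\<lambda>w. if w = g0 then a else b) ?S" for a b
      using ne by (simp add: lc)
    then have "C \<subseteq> span ?S" unfolding finite_span[OF S] C by blast
    moreover have "span ?S \<subseteq> C" unfolding finite_span[OF S] C by (auto simp: lc)
    ultimately show ?thesis by blast
  qed
  then have sub: "VectorSpace.subspace class_ring C V"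
    using span_is_subspace[OF S(2)] by simp
  then show "linear_code n C" by (simp add: linear_code_def)
  have subm: "submodule class_ring C V" using sub by (simp add: VectorSpace.subspace_def)
  have SC: "?S \<subseteq> C" using \<open>span ?S = C\<close> in_own_span[OF S(2)] by simp
  \<comment> \<open>\<open>code_dim\<close> measures the code as a space in its own right, so span
    and independence have to be moved there from the ambient space.\<close>
  interpret W: vectorspace class_ring "V\<lparr>carrier := C\<rparr>"
    using subspace_is_vs[OF sub] .
  have "\<not> lin_dep ?S"
    using indep by (intro finite_lin_indpt2[OF S]) (auto simp: lc)
  then have "W.basis ?S"
    using SC \<open>span ?S = C\<close> span_li_not_depend[OF SC subm] by (simp add: W.basis_def)
  then have "W.dim = card ?S" by (intro W.dim_basis S)
  then show "code_dim n C = 2" using ne by (simp add: code_dim_def)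
qed

lemma card_residue_class:
  fixes k m r :: nat
  assumes "r < k"
  shows "card {i. i < m * k \<and> i mod k = r} = m"
proof -
  have "{i. i < m * k \<and> i mod k = r} = (\<lambda>t. t * k + r) ` {..<m}"
  proof (intro equalityI subsetI)
    fix i assume i: "i \<in> {i. i < m * k \<and> i mod k = r}"
    then have "i = i div k * k + r" using div_mult_mod_eq[of i k] by simp
    moreover have "i div k < m" using i by (simp add: less_mult_imp_div_less)
    ultimately show "i \<in> (\<lambda>t. t * k + r) ` {..<m}" by blast
  next
    fix i assume "i \<in> (\<lambda>t. t * k + r) ` {..<m}"
    then obtain t where t: "t < m" "i = t * k + r" by blast
    have "t * k + r < Suc t * k" using assms by simp
    also have "\<dots> \<le> m * k" using t(1) by (intro mult_le_mono1) simp
    finally show "i \<in> {i. i < m * k \<and> i mod k = r}" using t(2) assms by simp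
  qed
  moreover have "inj_on (\<lambda>t. t * k + r) {..<m}" using assms by (auto simp: inj_on_def)
  ultimately show ?thesis by (simp add: card_image)
qed

section \<open>Codewords and weights from a primitive element\<close>

locale primitive_element =
  fixes \<omega> :: "'k::{field,finite}" and q :: nat
  assumes q3: "3 \<le> q" and card_UNIV: "card (UNIV :: 'k set) = q\<^sup>2"
    and primitive: "range (\<lambda>i::nat. \<omega> ^ i) = UNIV - {0}"
begin

definition n :: nat where "n = q\<^sup>2 - 1"

definition \<zeta> :: 'k where "\<zeta> = \<omega> ^ (q - 1)"

text \<open>Vectors are indexed from 0 but the points from 1, so position i carries the exponent i +
  1.\<close>

definition cw :: "'k \<Rightarrow> 'k \<Rightarrow> 'k vec" where "cw c0 c1 = vec n (\<lambda>i. c0 + c1 * \<zeta> ^ Suc i)"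

text \<open>The group of (q + 1)-th roots of unity, listed by the exponents 1, ..., q + 1 that make
  up one period of a codeword.\<close>

definition \<mu> :: "'k set" where "\<mu> = (\<lambda>r. \<zeta> ^ Suc r) ` {..<q + 1}"

lemma Suc_n: "Suc n = q\<^sup>2"
  using q3 by (simp add: n_def)

lemma n_eq: "n = (q - 1) * (q + 1)"
proof -
  obtain k where "q = Suc k" using q3 by (cases q) auto
  then show ?thesis unfolding n_def by (simp add: power2_eq_square)
qed

lemma n_less: "q\<^sup>2 - q < n" "0 < q\<^sup>2 - q" "1 < n"
proof -
  have "3 * q \<le> q * q" using q3 by (rule mult_le_mono1)
  then show "q\<^sup>2 - q < n" "0 < q\<^sup>2 - q" "1 < n"
    using q3 unfolding n_def power2_eq_square by linarith+
qed

lemma omega_nonzero: "\<omega> \<noteq> 0"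
  using primitive rangeI[of "\<lambda>i::nat. \<omega> ^ i" 1] by auto

lemma omega_n: "\<omega> ^ n = 1"
proof -
  have "\<omega> * \<omega> ^ n = \<omega>"
    using power_card_UNIV[of \<omega>] by (simp add: card_UNIV flip: Suc_n)
  then show ?thesis using omega_nonzero by simp
qed

text \<open>The powers have period n and cover all n nonzero elements, so the first n of them must
  be distinct.\<close>

lemma omega_inj: "inj_on (\<lambda>i. \<omega> ^ i) {..<n}"
proof (rule eq_card_imp_inj_on)
  have "\<omega> ^ i \<in> (\<lambda>i. \<omega> ^ i) ` {..<n}" for i
  proof -
    have "\<omega> ^ i = (\<omega> ^ n) ^ (i div n) * \<omega> ^ (i mod n)"
      by (metis div_mult_mod_eq mult.commute power_add power_mult)
    then have "\<omega> ^ i = \<omega> ^ (i mod n)" by (simp add: omega_n)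
    then show ?thesis using n_less by auto
  qed
  then have "(\<lambda>i. \<omega> ^ i) ` {..<n} = range (\<lambda>i::nat. \<omega> ^ i)" by blast
  then have "(\<lambda>i. \<omega> ^ i) ` {..<n} = UNIV - {0}" unfolding primitive .
  then have "card ((\<lambda>i. \<omega> ^ i) ` {..<n}) = card (UNIV - {0 :: 'k})" by simp
  also have "\<dots> = q\<^sup>2 - 1" by (simp add: card_UNIV)
  finally show "card ((\<lambda>i. \<omega> ^ i) ` {..<n}) = card {..<n}" by (simp add: n_def)
qed simp

lemma zeta_nonzero: "\<zeta> \<noteq> 0"
  using omega_nonzero by (simp add: \<zeta>_def)

lemma zeta_order: "\<zeta> ^ (q + 1) = 1"
  using omega_n unfolding \<zeta>_def power_mult[symmetric] n_eq .

lemma zeta_mod: "\<zeta> ^ (i mod (q + 1)) = \<zeta> ^ i"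
proof -
  have "\<zeta> ^ i = (\<zeta> ^ (q + 1)) ^ (i div (q + 1)) * \<zeta> ^ (i mod (q + 1))"
    by (metis div_mult_mod_eq mult.commute power_add power_mult)
  then show ?thesis unfolding zeta_order by simp
qed

lemma zeta_inj: "r < q + 1 \<Longrightarrow> s < q + 1 \<Longrightarrow> \<zeta> ^ r = \<zeta> ^ s \<Longrightarrow> r = s"
proof -
  assume rs: "r < q + 1" "s < q + 1" "\<zeta> ^ r = \<zeta> ^ s"
  then have "(q - 1) * r < n" "(q - 1) * s < n"
    unfolding n_eq using q3 by (intro mult_strict_left_mono; simp)+
  moreover have "\<omega> ^ ((q - 1) * r) = \<omega> ^ ((q - 1) * s)"
    using rs(3) by (simp add: \<zeta>_def power_mult)
  ultimately have "(q - 1) * r = (q - 1) * s" using omega_inj by (auto dest: inj_onD)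
  then show "r = s" using q3 by simp
qed

lemma card_mu: "card \<mu> = q + 1"
  unfolding \<mu>_def using zeta_inj zeta_nonzero by (subst card_image) (auto simp: inj_on_def)

text \<open>A codeword runs through the roots of unity in q - 1 full periods. They are distinct
  within a period, so a zero occurs once in each period or never.\<close>

lemma card_zeros:
  assumes "c1 \<noteq> 0"
  shows "card {i. i < n \<and> c0 + c1 * \<zeta> ^ Suc i = 0} = (if - c0 / c1 \<in> \<mu> then q - 1 else 0)"
proof -
  have root: "c0 + c1 * z = 0 \<longleftrightarrow> z = - c0 / c1" for z
    using assms by (auto simp: field_simps add_eq_0_iff)
  show ?thesis
  proof (cases "- c0 / c1 \<in> \<mu>")
    case True
    then obtain r where r: "r < q + 1" "- c0 / c1 = \<zeta> ^ Suc r" by (auto simp: \<mu>_def)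
    have "\<zeta> ^ Suc i = \<zeta> ^ Suc r \<longleftrightarrow> i mod (q + 1) = r" for i
      using zeta_inj[OF _ r(1), of "i mod (q + 1)"] zeta_mod[of i] zeta_nonzero by auto
    then have "{i. i < n \<and> c0 + c1 * \<zeta> ^ Suc i = 0} = {i. i < (q - 1) * (q + 1) \<and> i mod (q + 1) = r}"
      unfolding root r(2) n_eq by blast
    then show ?thesis using card_residue_class[OF r(1), of "q - 1"] True by simp
  next
    case False
    have "\<zeta> ^ Suc i \<in> \<mu>" for i
    proof -
      have "\<zeta> ^ Suc i = \<zeta> ^ Suc (i mod (q + 1))" using zeta_mod[of i] by simp
      then show ?thesis unfolding \<mu>_def by (intro image_eqI[of _ _ "i mod (q + 1)"]) simp_all
    qed
    then have "\<zeta> ^ Suc i \<noteq> - c0 / c1" for i using False by metis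
    then have "{i. i < n \<and> c0 + c1 * \<zeta> ^ Suc i = 0} = {}"
      unfolding root by blast
    then show ?thesis using False by simp
  qed
qed

lemma weight_cw:
  "hamming_weight (cw c0 c1) =
    (if c1 = 0 then if c0 = 0 then 0 else n else if - c0 / c1 \<in> \<mu> then q\<^sup>2 - q else n)"
proof -
  have "hamming_weight (cw c0 c1) = card ({..<n} - {i. i < n \<and> c0 + c1 * \<zeta> ^ Suc i = 0})"
    unfolding hamming_weight_def by (rule arg_cong[of _ _ card]) (auto simp: cw_def)
  also have "\<dots> = n - card {i. i < n \<and> c0 + c1 * \<zeta> ^ Suc i = 0}"
    by (subst card_Diff_subset) auto
  finally have w: "hamming_weight (cw c0 c1) = n - card {i. i < n \<and> c0 + c1 * \<zeta> ^ Suc i = 0}" .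
  have "n - (q - 1) = q\<^sup>2 - q" using q3 by (simp add: n_def)
  then show ?thesis
    unfolding w using card_zeros[of c1 c0] by (cases "c1 = 0"; cases "c0 = 0") auto
qed

lemma cw_linear: "cw c0 c1 = c0 \<cdot>\<^sub>v cw 1 0 + c1 \<cdot>\<^sub>v cw 0 1"
  by (rule eq_vecI) (auto simp: cw_def)

lemma cw_diff: "cw c0 c1 - cw d0 d1 = cw (c0 - d0) (c1 - d1)"
  by (rule eq_vecI) (auto simp: cw_def algebra_simps)

lemma cw_eq_0_iff: "cw c0 c1 = 0\<^sub>v n \<longleftrightarrow> c0 = 0 \<and> c1 = 0"
proof
  assume "cw c0 c1 = 0\<^sub>v n"
  then have "hamming_weight (cw c0 c1) = 0" by (simp add: hamming_weight_def)
  then show "c0 = 0 \<and> c1 = 0"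
    using n_less unfolding weight_cw by (auto split: if_splits)
qed (auto simp: cw_def)

lemma cw_eq_iff: "cw c0 c1 = cw d0 d1 \<longleftrightarrow> c0 = d0 \<and> c1 = d1"
proof
  assume "cw c0 c1 = cw d0 d1"
  then have "cw (c0 - d0) (c1 - d1) = 0\<^sub>v n"
    unfolding cw_diff[symmetric] by (simp add: cw_def)
  then show "c0 = d0 \<and> c1 = d1" by (simp add: cw_eq_0_iff)
qed simp

lemma dist_cw: "hamming_dist (cw c0 c1) (cw d0 d1) = hamming_weight (cw (c0 - d0) (c1 - d1))"
  unfolding hamming_dist_def hamming_weight_def cw_diff[symmetric]
  by (rule arg_cong[of _ _ card]) (auto simp: cw_def)

definition code :: "'k vec set" where "code = (\<lambda>(c0, c1). cw c0 c1) ` UNIV"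

lemma code_linear: "linear_code n code" "code_dim n code = 2"
proof -
  have c: "code = {a \<cdot>\<^sub>v cw 1 0 + b \<cdot>\<^sub>v cw 0 1 | a b. True}"
    unfolding code_def cw_linear[symmetric] by auto
  have "cw 1 0 \<in> carrier_vec n" "cw 0 1 \<in> carrier_vec n" by (auto simp: cw_def)
  from two_generator_code[OF this _ c] show "linear_code n code" "code_dim n code = 2"
    by (simp_all add: cw_eq_0_iff flip: cw_linear)
qed

text \<open>A shift multiplies \<open>c1\<close> by \<zeta>. The wrap-around is consistent because q
  + 1 divides n.\<close>

lemma code_cyclic: "cyclic_code n code"
  unfolding cyclic_code_def
proof (intro conjI ballI code_linear)
  fix c assume "c \<in> code"
  then obtain c0 c1 where c: "c = cw c0 c1" by (auto simp: code_def)
  have "\<zeta> ^ (Suc i mod n) = \<zeta> ^ Suc i" for i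
  proof -
    have "Suc i mod n mod (q + 1) = Suc i mod (q + 1)"
      by (rule mod_mod_cancel) (simp only: n_eq dvd_triv_right)
    then show ?thesis using zeta_mod[of "Suc i mod n"] zeta_mod[of "Suc i"] by metis
  qed
  then have "vec n (\<lambda>i. c $ (Suc i mod n)) = cw c0 (c1 * \<zeta>)"
    unfolding c using n_less by (intro eq_vecI) (simp_all add: cw_def)
  then show "vec n (\<lambda>i. c $ (Suc i mod n)) \<in> code" by (auto simp: code_def)
qed

lemma mem_mu: "\<zeta> \<in> \<mu>"
  unfolding \<mu>_def by (rule image_eqI[of _ _ 0]) simp_all

lemma code_nonzero: "code - {0\<^sub>v n} = {cw c0 c1 | c0 c1. \<not> (c0 = 0 \<and> c1 = 0)}"
  by (auto simp: code_def cw_eq_0_iff cw_eq_iff)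

lemma code_weights: "hamming_weight ` (code - {0\<^sub>v n}) = {q\<^sup>2 - q, n}"
proof (intro equalityI subsetI)
  fix w assume "w \<in> hamming_weight ` (code - {0\<^sub>v n})"
  then obtain c0 c1 where "\<not> (c0 = 0 \<and> c1 = 0)" "w = hamming_weight (cw c0 c1)"
    unfolding code_nonzero by blast
  then show "w \<in> {q\<^sup>2 - q, n}" by (auto simp: weight_cw)
next
  fix w assume "w \<in> {q\<^sup>2 - q, n}"
  \<comment> \<open>The constant word has no zero; the other one has the entry -\<zeta> + \<zeta> =
    0 at its first position and hence the low weight.\<close>
  moreover have "cw 1 0 \<in> code - {0\<^sub>v n}" "cw (- \<zeta>) 1 \<in> code - {0\<^sub>v n}"
    unfolding code_nonzero by (auto simp: cw_eq_iff)
  moreover have "hamming_weight (cw 1 0) = n" "hamming_weight (cw (- \<zeta>) 1) = q\<^sup>2 - q"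
    using mem_mu by (simp_all add: weight_cw)
  ultimately show "w \<in> hamming_weight ` (code - {0\<^sub>v n})"
    by (metis image_eqI insertE singletonD)
qed

lemma code_min_distance: "min_distance code = q\<^sup>2 - q"
proof -
  have "{hamming_dist c d | c d. c \<in> code \<and> d \<in> code \<and> c \<noteq> d} = hamming_weight ` (code - {0\<^sub>v n})"
  proof (intro equalityI subsetI)
    fix w assume "w \<in> {hamming_dist c d | c d. c \<in> code \<and> d \<in> code \<and> c \<noteq> d}"
    then obtain c0 c1 d0 d1 where "w = hamming_dist (cw c0 c1) (cw d0 d1)" "cw c0 c1 \<noteq> cw d0 d1"
      by (auto simp: code_def)
    then have "w = hamming_weight (cw (c0 - d0) (c1 - d1))" "cw (c0 - d0) (c1 - d1) \<in> code - {0\<^sub>v n}"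
      by (auto simp: dist_cw cw_eq_iff cw_eq_0_iff code_def)
    then show "w \<in> hamming_weight ` (code - {0\<^sub>v n})" by blast
  next
    fix w assume "w \<in> hamming_weight ` (code - {0\<^sub>v n})"
    then obtain c0 c1 where "\<not> (c0 = 0 \<and> c1 = 0)" "w = hamming_weight (cw c0 c1)"
      unfolding code_nonzero by blast
    then have "w = hamming_dist (cw c0 c1) (cw 0 0)" "cw c0 c1 \<noteq> cw 0 0"
      by (simp_all add: dist_cw cw_eq_iff)
    then show "w \<in> {hamming_dist c d | c d. c \<in> code \<and> d \<in> code \<and> c \<noteq> d}"
      by (auto simp: code_def)
  qed
  then have "min_distance code = Inf {q\<^sup>2 - q, n}"
    by (simp only: min_distance_def code_weights)
  also have "\<dots> = Min {q\<^sup>2 - q, n}" by (rule cInf_eq_Min) simp_all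
  finally show ?thesis using n_less(1) by simp
qed

text \<open>A pair is determined by \<open>c1\<close> and the root s = -c0/c1 of c0 + c1 z: n
  choices for the former, q + 1 for the latter.\<close>

lemma card_low_weight_pairs: "card {(c0, c1). c1 \<noteq> 0 \<and> - c0 / c1 \<in> \<mu>} = n * (q + 1)"
proof -
  have "bij_betw (\<lambda>(c1, s). (- s * c1, c1)) ((UNIV - {0}) \<times> \<mu>) {(c0, c1). c1 \<noteq> 0 \<and> - c0 / c1 \<in> \<mu>}"
    by (rule bij_betw_byWitness[of _ "\<lambda>(c0, c1). (c1, - c0 / c1)"]) auto
  then have "card {(c0, c1). c1 \<noteq> 0 \<and> - c0 / c1 \<in> \<mu>} = card ((UNIV - {0 :: 'k}) \<times> \<mu>)"
    by (rule bij_betw_same_card[symmetric])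
  also have "\<dots> = n * (q + 1)"
    by (simp add: card_cartesian_product card_mu card_UNIV n_def)
  finally show ?thesis .
qed

lemma card_code_image: "card ((\<lambda>(c0, c1). cw c0 c1) ` T) = card T"
  by (rule card_image) (auto simp: inj_on_def cw_eq_iff)

lemma card_low_weight: "card {c \<in> code. hamming_weight c = q\<^sup>2 - q} = n * (q + 1)"
proof -
  have "{c \<in> code. hamming_weight c = q\<^sup>2 - q} =
    (\<lambda>(c0, c1). cw c0 c1) ` {(c0, c1). c1 \<noteq> 0 \<and> - c0 / c1 \<in> \<mu>}"
    using n_less by (auto simp: code_def weight_cw split: if_splits)
  then show ?thesis by (simp only: card_code_image card_low_weight_pairs)
qed

lemma card_high_weight: "card {c \<in> code. hamming_weight c = n} = q * (q - 1) * n"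
proof -
  let ?L = "{(c0, c1). c1 \<noteq> 0 \<and> - c0 / c1 \<in> \<mu>}"
  have "{c \<in> code. hamming_weight c = n} = (\<lambda>(c0, c1). cw c0 c1) ` (UNIV - insert (0, 0) ?L)"
    using n_less by (auto simp: code_def weight_cw cw_eq_iff split: if_splits)
  then have "card {c \<in> code. hamming_weight c = n} = card (UNIV - insert (0, 0) ?L)"
    by (simp only: card_code_image)
  also have "\<dots> = card (UNIV :: ('k \<times> 'k) set) - card (insert (0, 0) ?L)"
    by (rule card_Diff_subset) simp_all
  also have "card (insert (0, 0) ?L) = Suc (n * (q + 1))"
    unfolding card_low_weight_pairs[symmetric] by (rule card_insert_disjoint) simp_all
  also have "card (UNIV :: ('k \<times> 'k) set) = q\<^sup>2 * q\<^sup>2"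
    using card_cartesian_product[of "UNIV :: 'k set" "UNIV :: 'k set"]
    unfolding UNIV_Times_UNIV card_UNIV .
  \<comment> \<open>q^4 - 1 = n (q^2 + 1), and removing n (q + 1) leaves n (q^2 - q).\<close>
  also have "q\<^sup>2 * q\<^sup>2 - Suc (n * (q + 1)) = q * (q - 1) * n"
  proof -
    obtain k where "q = Suc k" using q3 by (cases q) auto
    then show ?thesis unfolding n_eq by (simp add: power2_eq_square algebra_simps)
  qed
  finally show ?thesis .
qed

end

section \<open>Evaluation at the points of the orbit\<close>

context hermitian_square
begin

text \<open>At the j-th point, y/x^2 takes the value (v/u^2) \<zeta>^j, the exponent of \<omega>
  being (q + 1) j - 2 j. The factor v/u^2 is nonzero, as v = 0 would force u = 0, so it can be
  absorbed into the second coefficient.\<close>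

lemma hermitian_code_eq:
  assumes "primitive_element \<omega> q" and u: "u \<noteq> 0" and uv: "v ^ q + v = u ^ (q + 1)"
  shows "hermitian_code emb q x y u v \<omega> 2 = primitive_element.code \<omega> q"
proof -
  interpret W: primitive_element \<omega> q by fact
  have "v \<noteq> 0" using u uv q2 by (auto simp: power_0_left)
  let ?g = "v / u\<^sup>2"
  have g: "?g \<noteq> 0" using u \<open>v \<noteq> 0\<close> by simp
  have eval: "eval_at emb (pl (\<omega> ^ j * u) (\<omega> ^ ((q + 1) * j) * v)) (emb c0 + emb c1 * (y / x\<^sup>2))
    = c0 + c1 * ?g * W.\<zeta> ^ j" for j c0 c1
  proof -
    \<comment> \<open>Powers of \<omega>^(q+1) lie in the subfield with q elements and are fixed by
      the q-th power; this keeps the j-th point on the curve.\<close>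
    have "(\<omega> ^ ((q + 1) * j)) ^ q = \<omega> ^ ((q + 1) * j)"
    proof -
      have "(q + 1) * q = W.n + (q + 1)" using W.Suc_n by (simp add: power2_eq_square)
      then have "(q + 1) * j * q = (W.n + (q + 1)) * j" by (metis mult.assoc mult.commute)
      then have "(q + 1) * j * q = W.n * j + (q + 1) * j" by (simp only: add_mult_distrib)
      then have "(\<omega> ^ ((q + 1) * j)) ^ q = (\<omega> ^ W.n) ^ j * \<omega> ^ ((q + 1) * j)"
        by (simp only: power_mult[symmetric] power_add)
      then show ?thesis by (simp only: W.omega_n power_one mult_1)
    qed
    then have "(\<omega> ^ ((q + 1) * j) * v) ^ q + \<omega> ^ ((q + 1) * j) * v = \<omega> ^ ((q + 1) * j) * (v ^ q + v)"
      by (simp add: power_mult_distrib distrib_left)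
    also have "\<dots> = (\<omega> ^ j * u) ^ (q + 1)"
      unfolding uv power_mult_distrib by (simp only: power_mult[symmetric] mult.commute)
    finally have eval: "eval_at emb (pl (\<omega> ^ j * u) (\<omega> ^ ((q + 1) * j) * v)) (emb c0 + emb c1 * (y / x\<^sup>2))
      = c0 + c1 * (\<omega> ^ ((q + 1) * j) * v / (\<omega> ^ j * u)\<^sup>2)"
      using u W.omega_nonzero by (intro eval_at_span) simp_all
    have power: "\<omega> ^ ((q + 1) * j) = W.\<zeta> ^ j * (\<omega> ^ j)\<^sup>2"
    proof -
      have "(q + 1) * j = (q - 1) * j + j * 2" using q2 by (cases q) simp_all
      then show ?thesis by (simp only: W.\<zeta>_def power_add power_mult)
    qed
    have "\<omega> ^ ((q + 1) * j) * v / (\<omega> ^ j * u)\<^sup>2 = ?g * W.\<zeta> ^ j"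
      unfolding power using W.omega_nonzero u by (simp add: power_mult_distrib)
    then show ?thesis unfolding eval by (simp add: mult.assoc)
  qed
  have "hermitian_code emb q x y u v \<omega> 2 =
    (\<lambda>(c0, c1). W.cw c0 (c1 * ?g)) ` UNIV"
    unfolding hermitian_code_def ag_code_def riemann_roch_eq image_image W.cw_def W.n_def
    by (simp only: case_prod_unfold eval)
  also have "\<dots> = W.code"
  proof -
    have "W.cw c0 c1 \<in> (\<lambda>(c0, c1). W.cw c0 (c1 * ?g)) ` UNIV" for c0 c1
      using g by (intro image_eqI[of _ _ "(c0, c1 / ?g)"]) simp_all
    then show ?thesis by (auto simp: W.code_def)
  qed
  finally show ?thesis .
qed

end

theorem theorem2:
  fixes q :: nat and emb :: "'k::{field,finite} \<Rightarrow> 'f::field" and x y :: 'f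
    and u v \<omega> :: 'k and C :: "'k vec set"
  assumes "primepow q" and "q \<ge> 3" and "card (UNIV :: 'k set) = q\<^sup>2"
    and "hermitian_function_field emb q x y"
    and "u \<noteq> 0" and "v ^ q + v = u ^ (q + 1)"
    and "range (\<lambda>i::nat. \<omega> ^ i) = UNIV - {0}"
    and "C = hermitian_code emb q x y u v \<omega> 2"
  shows "is_nkd_code (q\<^sup>2 - 1) 2 (q\<^sup>2 - q) C
       \<and> cyclic_code (q\<^sup>2 - 1) C
       \<and> two_weight_code (q\<^sup>2 - 1) (q\<^sup>2 - q) (q\<^sup>2 - 1) C
       \<and> card {c \<in> C. hamming_weight c = q\<^sup>2 - q} = (q\<^sup>2 - 1) * (q + 1)
       \<and> card {c \<in> C. hamming_weight c = q\<^sup>2 - 1} = q * (q - 1) * (q\<^sup>2 - 1)"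
proof -
  have "q + 1 < q\<^sup>2"
  proof -
    have "3 * q \<le> q * q" using assms(2) by (rule mult_le_mono1)
    then show ?thesis using assms(2) unfolding power2_eq_square by linarith
  qed
  then interpret H: hermitian_square emb q x y
    using assms(1-4)
    by (simp add: hermitian_square_def hermitian_square_axioms_def hermitian_field_def hermitian_field_axioms_def)
  interpret W: primitive_element \<omega> q
    using assms by unfold_locales
  have C: "C = W.code"
    using H.hermitian_code_eq[OF W.primitive_element_axioms assms(5,6)] assms(8) by simp
  note n = W.n_def[symmetric]
  show ?thesis
    unfolding C n is_nkd_code_def two_weight_code_def
    using W.code_linear W.code_cyclic W.code_min_distance W.code_weights W.n_less(1)
      W.card_low_weight W.card_high_weight by auto
qed

end
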